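(* Every expanded lattice angle is proper lattice-congruent to exactly one of the following expanded lattice angles: the angle $0\pi+\operatorname{larctan}(0)=\angle(O,(1,0))$ (type I); the angles $\Phi_S$ with $S$ of type II$_k$ ($k\ge1$), III$_k$ ($k\ge1$), IV$_k$ ($k\ge0$, $n\ge0$, $a_0,\dots,a_{2n}$ positive integers) or V$_k$ ($k\ge1$, $n\ge0$, $a_0,\dots,a_{2n}$ positive integers). In particular the type is uniquely determined, and within each type the listed angle is unique.
   Context: We work in $\mathbb R^2$ with standard orientation, lattice $\mathbb Z^2$, origin $O$. A lattice-affine transformation $x\mapsto Mx+b$ ($M\in GL_2(\mathbb Z)$, $b\in\mathbb Z^2$) is proper if $\det M=1$. $\operatorname{l\ell}(AB)$ is the number of lattice points on segment $AB$ minus one; $\operatorname{sgn}(A,B,C)$ is the sign of $\det(A-B,C-B)$. For an ordinary lattice angle $\angle XYZ$ (lattice points not collinear, rays $YX$, $YZ$) let $v_1,v_2$ be primitive lattice vectors along $YX$, $YZ$; lattice points $P$ with $(v_1,P-Y)$ a basis form two lines parallel to $YX$, ray $YZ$ meets exactly one, $l$, at $Q$; let $D$ be the lattice point of $l$ nearest $Q$ among those strictly on the other side of line $YZ$ from $X$; writing $v_2=x_1v_1+x_2(D-Y)$, $\operatorname{lsin}\angle XYZ=x_2$. A lattice oriented broken line $A_0A_1\dots A_n$ ($n\ge1$) is a sequence of lattice points with $A_{i-1}\ne A_i$ and no two consecutive segments in one line; it is on unit distance from lattice point $V$ if for each $i$ the primitive vector along $A_{i-1}A_i$ and $V-A_{i-1}$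 form a basis of $\mathbb Z^2$. Its signed length-sine sequence is $(a_0,\dots,a_{2n-2})$ with $a_{2i-2}=\operatorname{sgn}(A_{i-1},V,A_i)\operatorname{l\ell}(A_{i-1}A_i)$ and $a_{2i-1}=\operatorname{sgn}(A_{i-1},V,A_i)\operatorname{sgn}(A_i,V,A_{i+1})\operatorname{sgn}(A_{i-1},A_i,A_{i+1})\operatorname{lsin}\angle A_{i-1}A_iA_{i+1}$. Two such broken lines on unit distance from $V$ are equivalent if they have the same first and last vertices and the closed path formed by the first followed by the reverse of the second is null-homotopic in $\mathbb R^2\setminus\{V\}$. The equivalence class of $A_0\dots A_n$ is the expanded lattice angle $\angle(V,A_0A_1\dots A_n)$; we also allow the one-point broken line, giving $\angle(V,A_0)$. Two expanded lattice angles are proper lattice-congruent if a proper lattice-affine transformation sends the vertex and class of one to the vertex and class of the other. Normal forms: $(x_1,\dots,x_r)\times j$ denotes $j$ consecutive copies of $(x_1,\dots,x_r)$. For a finite sequence $S$ of nonzero integers, $\Phi_S=\angle(O,A_0A_1\dots A_s)$ where $A_0\dots A_s$ is the lattice oriented broken line on unit distance from $O$ with $A_0=(1,0)$, $A_1$ on the line $x=1$, and signed length-sine sequence $S$ (for the sequences below it exists and is unique). Types: II$_k$: $S=((1,-2,1,-2)\times(k-1),1,-2,1)$, denoted $k\pi+\operatorname{larctan}(0)$; III$_k$: $S=((-1,2,-1,2)\times(k-1),-1,2,-1)$, denoted $-k\pi+\operatorname{larctan}(0)$; IV$_k$: $S=((1,-2,1,-2)\times k,a_0,\dots,a_{2n})$,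 denoted $k\pi+\operatorname{larctan}([a_0;a_1,\dots,a_{2n}])$; V$_k$: $S=((-1,2,-1,2)\times k,a_0,\dots,a_{2n})$, denoted $-k\pi+\operatorname{larctan}([a_0;a_1,\dots,a_{2n}])$.
   Formalization: For the one-point broken line giving ∠(V,A_0), the vector V−A_0 is required to be primitive; without this the claim fails, e.g. ∠(O,(2,0)) is not proper lattice-congruent to any listed angle. One-point lines take part in the equivalence of broken lines. *)

theory Defs
  imports "HOL-Analysis.Analysis"
begin

text \<open>Points of the lattice $Z^2$ have type \<open>int^2\<close>; \<open>emb\<close> is the inclusion into the plane.\<close>

type_synonym lpoint = "int^2"

definition emb :: "lpoint \<Rightarrow> real^2" where
  "emb P = (\<chi> i. of_int (P $ i))"

definition lattice_basis :: "lpoint \<Rightarrow> lpoint \<Rightarrow> bool" where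
  "lattice_basis u v \<longleftrightarrow> (\<forall>w. \<exists>!(m, n). w = m *s u + n *s v)"

definition primitive :: "lpoint \<Rightarrow> bool" where
  "primitive v \<longleftrightarrow> coprime (v $ 1) (v $ 2)"

definition prim_vec :: "lpoint \<Rightarrow> lpoint \<Rightarrow> lpoint" where
  "prim_vec A B = (THE v. primitive v \<and> (\<exists>m>0. B - A = m *s v))"

definition lattice_length :: "lpoint \<Rightarrow> lpoint \<Rightarrow> nat" where
  "lattice_length A B = card {P. emb P \<in> closed_segment (emb A) (emb B)} - 1"

definition osign :: "lpoint \<Rightarrow> lpoint \<Rightarrow> lpoint \<Rightarrow> int" where
  "osign A B C = sgn (det (vector [A - B, C - B] :: int^2^2))"


subsection \<open>Lattice sine\<close>

definition ray :: "lpoint \<Rightarrow> lpoint \<Rightarrow> (real^2) set" where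
  "ray Y Z = {emb Y + t *\<^sub>R (emb Z - emb Y) | t. t \<ge> 0}"

text \<open>The lines parallel to \<open>YX\<close> carrying the lattice points \<open>P\<close> for which the primitive vector
  along \<open>YX\<close> and \<open>P - Y\<close> form a basis.\<close>

definition unit_lines :: "lpoint \<Rightarrow> lpoint \<Rightarrow> (real^2) set set" where
  "unit_lines Y X =
     {{emb P + t *\<^sub>R emb (prim_vec Y X) | t. True} | P. lattice_basis (prim_vec Y X) (P - Y)}"

definition lsin :: "lpoint \<Rightarrow> lpoint \<Rightarrow> lpoint \<Rightarrow> int" where
  "lsin X Y Z = (THE x2. \<exists>x1 l Q D.
      l \<in> unit_lines Y X \<and> Q \<in> l \<and> Q \<in> ray Y Z \<and>
      is_arg_min (\<lambda>P. dist (emb P) Q) (\<lambda>P. emb P \<in> l \<and> osign X Y Z * osign P Y Z < 0) D \<and>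
      prim_vec Y Z = x1 *s prim_vec Y X + x2 *s (D - Y))"


subsection \<open>Lattice oriented broken lines\<close>

definition broken_line :: "lpoint list \<Rightarrow> bool" where
  "broken_line As \<longleftrightarrow> length As \<ge> 2 \<and>
     (\<forall>i. i + 1 < length As \<longrightarrow> As ! i \<noteq> As ! (i + 1)) \<and>
     (\<forall>i. i + 2 < length As \<longrightarrow>
        \<not> collinear {emb (As ! i), emb (As ! (i + 1)), emb (As ! (i + 2))})"

definition unit_distance :: "lpoint \<Rightarrow> lpoint list \<Rightarrow> bool" where
  "unit_distance V As \<longleftrightarrow>
     (\<forall>i. i + 1 < length As \<longrightarrow> lattice_basis (prim_vec (As ! i) (As ! (i + 1))) (V - As ! i))"

definition signed_length_sine :: "lpoint \<Rightarrow> lpoint list \<Rightarrow> int list" where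
  "signed_length_sine V As =
     map (\<lambda>j. let i = j div 2 in
           if even j then osign (As ! i) V (As ! (i + 1)) * int (lattice_length (As ! i) (As ! (i + 1)))
           else osign (As ! i) V (As ! (i + 1)) * osign (As ! (i + 1)) V (As ! (i + 2)) *
                osign (As ! i) (As ! (i + 1)) (As ! (i + 2)) *
                lsin (As ! i) (As ! (i + 1)) (As ! (i + 2)))
       [0..<2 * (length As - 1) - 1]"

text \<open>A one-point broken line has no segment to impose unit distance from the vertex; as for the
  vertices of all longer lines on unit distance, the vector from its point to \<open>V\<close> is required
  to be primitive.\<close>

definition unit_broken_line :: "lpoint \<Rightarrow> lpoint list \<Rightarrow> bool" where
  "unit_broken_line V As \<longleftrightarrow>
     broken_line As \<and> unit_distance V As \<or> (\<exists>A. As = [A] \<and> primitive (V - A))"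

fun broken_path :: "lpoint list \<Rightarrow> real \<Rightarrow> real^2" where
  "broken_path [A] = linepath (emb A) (emb A)"
| "broken_path [A, B] = linepath (emb A) (emb B)"
| "broken_path (A # B # C # As) = linepath (emb A) (emb B) +++ broken_path (B # C # As)"


subsection \<open>Expanded lattice angles\<close>

definition line_equiv :: "lpoint \<Rightarrow> lpoint list \<Rightarrow> lpoint list \<Rightarrow> bool" where
  "line_equiv V As Bs \<longleftrightarrow> unit_broken_line V As \<and> unit_broken_line V Bs \<and>
     hd As = hd Bs \<and> last As = last Bs \<and>
     (\<exists>c. homotopic_loops (UNIV - {emb V})
            (broken_path As +++ reversepath (broken_path Bs)) (linepath c c))"

text \<open>An expanded lattice angle is the pair of its vertex and an equivalence class.\<close>

type_synonym exp_angle = "lpoint \<times> lpoint list set"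

definition angle :: "lpoint \<Rightarrow> lpoint list \<Rightarrow> exp_angle" where
  "angle V As = (V, {Bs. line_equiv V As Bs})"

definition expanded_lattice_angle :: "exp_angle \<Rightarrow> bool" where
  "expanded_lattice_angle \<alpha> \<longleftrightarrow> (\<exists>V As. unit_broken_line V As \<and> \<alpha> = angle V As)"

definition proper_lattice_affine :: "(lpoint \<Rightarrow> lpoint) \<Rightarrow> bool" where
  "proper_lattice_affine f \<longleftrightarrow>
     (\<exists>(M :: int^2^2) b. invertible M \<and> det M = 1 \<and> f = (\<lambda>x. M *v x + b))"

definition proper_congruent :: "exp_angle \<Rightarrow> exp_angle \<Rightarrow> bool" where
  "proper_congruent \<alpha> \<beta> \<longleftrightarrow>
     (\<exists>f. proper_lattice_affine f \<and> f (fst \<alpha>) = fst \<beta> \<and> map f ` snd \<alpha> = snd \<beta>)"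


subsection \<open>Normal forms\<close>

definition Phi :: "int list \<Rightarrow> exp_angle" where
  "Phi S = angle 0 (THE As. broken_line As \<and> unit_distance 0 As \<and>
     As ! 0 = vector [1, 0] \<and> (As ! 1) $ 1 = 1 \<and> signed_length_sine 0 As = S)"

definition copies :: "int list \<Rightarrow> nat \<Rightarrow> int list" where
  "copies xs j = concat (replicate j xs)"

datatype normal_form =
    Type_I
  | Type_II nat
  | Type_III nat
  | Type_IV nat "int list"
  | Type_V nat "int list"

definition cf_elements :: "int list \<Rightarrow> bool" where
  "cf_elements as \<longleftrightarrow> (\<exists>n. length as = 2 * n + 1) \<and> (\<forall>a \<in> set as. a > 0)"

fun valid_form :: "normal_form \<Rightarrow> bool" where
  "valid_form Type_I \<longleftrightarrow> True"
| "valid_form (Type_II k) \<longleftrightarrow> k \<ge> 1"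
| "valid_form (Type_III k) \<longleftrightarrow> k \<ge> 1"
| "valid_form (Type_IV k as) \<longleftrightarrow> cf_elements as"
| "valid_form (Type_V k as) \<longleftrightarrow> k \<ge> 1 \<and> cf_elements as"

fun form_angle :: "normal_form \<Rightarrow> exp_angle" where
  "form_angle Type_I = angle 0 [vector [1, 0]]"
| "form_angle (Type_II k) = Phi (copies [1, -2, 1, -2] (k - 1) @ [1, -2, 1])"
| "form_angle (Type_III k) = Phi (copies [-1, 2, -1, 2] (k - 1) @ [-1, 2, -1])"
| "form_angle (Type_IV k as) = Phi (copies [1, -2, 1, -2] k @ as)"
| "form_angle (Type_V k as) = Phi (copies [-1, 2, -1, 2] k @ as)"

end

theory Submission imports Defs "HOL-Complex_Analysis.Riemann_Mapping" begin

text \<open>Put the vertex at the origin. A line on unit distance is generated by its first vertex \<open>A\<close>, a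
  vector \<open>w\<close> with \<open>det (A, w) = 1\<close>, and its signed length-sine sequence, through the continued
  fraction recursion; so \<open>Phi S\<close> is explicit. The total angle turned around the origin is
  \<open>2 * pi\<close> times the real part of the winding number, hence two lines are equivalent iff they have
  the same end points and the same total turn. From every \<open>(A, w)\<close> the blocks \<open>(1, -2, 1, -2)\<close> and
  \<open>(-1, 2, -1, 2)\<close> turn by exactly \<open>pi\<close> and \<open>-pi\<close>, and a positive continued fraction by an angle
  between \<open>0\<close> and \<open>pi\<close>. A proper transformation moves the first vertex to \<open>(1, 0)\<close>; the remaining
  freedom is a horizontal shear, which brings the last vertex to \<open>\<plusminus>(1, 0)\<close> or to \<open>\<plusminus>(q, p)\<close> with
  \<open>1 \<le> q \<le> p\<close> in exactly one way, and which does not change the number of half turns.\<close>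

subsection \<open>The cross product of the plane\<close>

definition cross2 :: "'a::comm_ring_1^2 \<Rightarrow> 'a^2 \<Rightarrow> 'a" where
  "cross2 u v = u$1 * v$2 - u$2 * v$1"

lemma vec_eq_iff_2: "(u :: 'a^2) = v \<longleftrightarrow> u$1 = v$1 \<and> u$2 = v$2"
  by (simp add: vec_eq_iff forall_2)

lemma cross2_simps [simp]:
  "cross2 (m *s u) v = m * cross2 u v" "cross2 u (m *s v) = m * cross2 u v"
  "cross2 (- u) v = - cross2 u v" "cross2 u (- v) = - cross2 u v"
  "cross2 u u = 0" "cross2 0 u = 0" "cross2 u 0 = 0"
  by (simp_all add: cross2_def algebra_simps)

lemma cross2_scaleR [simp]:
  "cross2 (r *\<^sub>R u) v = r * cross2 u v" "cross2 u (r *\<^sub>R v) = r * cross2 u v" for u v :: "real^2"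
  by (simp_all add: cross2_def algebra_simps)

lemma cross2_distribs:
  "cross2 (u + v) w = cross2 u w + cross2 v w" "cross2 w (u + v) = cross2 w u + cross2 w v"
  "cross2 (u - v) w = cross2 u w - cross2 v w" "cross2 w (u - v) = cross2 w u - cross2 w v"
  by (simp_all add: cross2_def algebra_simps)

lemma cross2_swap: "cross2 v u = - cross2 u v"
  by (simp add: cross2_def)

lemma det_vector_2: "det (vector [u, v]) = cross2 u v"
  by (simp add: det_2 cross2_def)

lemma cross2_matrix_mult: "cross2 (M *v u) (M *v v) = det M * cross2 u v"
  by (simp add: cross2_def det_2 matrix_vector_mult_def sum_2 algebra_simps)

lemma cross2_cramer: "cross2 u v *s w = cross2 w v *s u + cross2 u w *s v"
  by (simp add: vec_eq_iff_2 cross2_def algebra_simps)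

lemma cross2_eq_0_imp_multiple:
  assumes "cross2 u w = 1" "cross2 u v = 0"
  shows "v = cross2 v w *s u"
  using cross2_cramer[of u w v] assms by simp

lemma collinear_iff_cross2: "collinear {0, u, v} \<longleftrightarrow> cross2 u v = 0" for u v :: "real^2"
proof
  assume "collinear {0, u, v}"
  then show "cross2 u v = 0" by (auto simp: collinear_lemma)
next
  assume zero: "cross2 u v = 0"
  show "collinear {0, u, v}"
  proof (cases "u = 0")
    case False
    define w :: "real^2" where "w = vector [- u$2, u$1]"
    have "cross2 u w = (u$1)\<^sup>2 + (u$2)\<^sup>2" by (simp add: w_def cross2_def power2_eq_square)
    then have w_nonzero: "cross2 u w \<noteq> 0"
      using False by (simp add: vec_eq_iff_2 sum_power2_eq_zero_iff)
    have "cross2 u w *\<^sub>R v = cross2 v w *\<^sub>R u"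
      using cross2_cramer[of u w v] zero by (simp add: scalar_mult_eq_scaleR)
    then have "v = (cross2 v w / cross2 u w) *\<^sub>R u"
      using w_nonzero by (metis divide_inverse_commute scaleR_scaleR scaleR_one left_inverse)
    then show ?thesis unfolding collinear_lemma by blast
  qed simp
qed

abbreviation e1 :: lpoint where "e1 \<equiv> vector [1, 0]"
abbreviation e2 :: lpoint where "e2 \<equiv> vector [0, 1]"

lemma cross2_e1_e2: "cross2 e1 e2 = 1"
  by (simp add: cross2_def)

subsection \<open>Bases and primitive vectors of the lattice\<close>

lemma lattice_basis_iff_cross2: "lattice_basis u v \<longleftrightarrow> \<bar>cross2 u v\<bar> = 1"
proof
  assume "lattice_basis u v"
  then have span: "\<exists>m n. w = m *s u + n *s v" for w
    unfolding lattice_basis_def by (metis (mono_tags, lifting) case_prodE)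
  obtain a b c d where standard_basis: "e1 = a *s u + b *s v" "e2 = c *s u + d *s v"
    using span by metis
  have "1 = cross2 e1 e2" by (simp add: cross2_e1_e2)
  also have "\<dots> = (a * d - b * c) * cross2 u v"
    unfolding standard_basis by (simp add: cross2_def algebra_simps)
  finally have "cross2 u v dvd 1" by (metis dvd_triv_right)
  then show "\<bar>cross2 u v\<bar> = 1" by simp
next
  assume "\<bar>cross2 u v\<bar> = 1"
  then have cross2_squared: "cross2 u v * cross2 u v = 1" by (metis abs_mult_self_eq mult_1)
  have "w = m *s u + n *s v \<longleftrightarrow> m = cross2 u v * cross2 w v \<and> n = cross2 u v * cross2 u w"
    for w m n
  proof
    assume "w = m *s u + n *s v"
    then show "m = cross2 u v * cross2 w v \<and> n = cross2 u v * cross2 u w"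
      using cross2_squared by (simp add: cross2_distribs mult.left_commute)
  next
    have "w = cross2 u v *s (cross2 u v *s w)" by (simp add: vector_smult_assoc cross2_squared)
    also have "\<dots> = (cross2 u v * cross2 w v) *s u + (cross2 u v * cross2 u w) *s v"
      unfolding cross2_cramer[of u v w] by (simp add: vector_add_ldistrib vector_smult_assoc)
    finally show "w = m *s u + n *s v"
      if "m = cross2 u v * cross2 w v \<and> n = cross2 u v * cross2 u w" using that by simp
  qed
  then show "lattice_basis u v" unfolding lattice_basis_def by auto
qed

lemma primitive_iff_cross2: "primitive u \<longleftrightarrow> (\<exists>w. cross2 u w = 1)"
proof
  assume "primitive u"
  then obtain a b where "a * u$1 + b * u$2 = 1"
    unfolding primitive_def by (metis coprime_iff_gcd_eq_1 bezout_int)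
  then have "cross2 u (vector [-b, a]) = 1" by (simp add: cross2_def algebra_simps)
  then show "\<exists>w. cross2 u w = 1" by blast
next
  assume "\<exists>w. cross2 u w = 1"
  then obtain w where dual: "cross2 u w = 1" by blast
  show "primitive u" unfolding primitive_def
  proof (rule coprimeI)
    fix c assume "c dvd u$1" "c dvd u$2"
    then have "c dvd cross2 u w" unfolding cross2_def by (simp add: dvd_diff)
    then show "is_unit c" using dual by simp
  qed
qed

lemma primitive_if_abs_cross2:
  assumes "\<bar>cross2 u w\<bar> = 1"
  shows "primitive u"
proof -
  have "cross2 u (cross2 u w *s w) = 1" using assms by (auto simp: abs_if split: if_splits)
  then show ?thesis using primitive_iff_cross2 by blast
qed

lemma gcd_scaled_primitive: "primitive u \<Longrightarrow> m \<ge> 0 \<Longrightarrow> gcd ((m *s u)$1) ((m *s u)$2) = m"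
  by (simp add: primitive_def coprime_iff_gcd_eq_1 flip: gcd_mult_distrib_int)

lemma prim_vec_eqI:
  assumes "primitive u" "m > 0" "B = A + m *s u"
  shows "prim_vec A B = u"
  unfolding prim_vec_def
proof (rule the_equality)
  fix v assume "primitive v \<and> (\<exists>n>0. B - A = n *s v)"
  then obtain n where multiple: "primitive v" "n > 0" "m *s u = n *s v" using assms(3) by auto
  then have "m = n" using assms(1,2) gcd_scaled_primitive by (metis less_imp_le)
  then show "v = u" using multiple assms(2) by (simp add: vec_eq_iff_2)
qed (use assms in auto)

lemma prim_vecE:
  assumes "A \<noteq> B"
  obtains m where "m > 0" "primitive (prim_vec A B)" "B = A + m *s prim_vec A B"
proof -
  define d g where "d = B - A" and "g = gcd (d$1) (d$2)"
  have "d \<noteq> 0" using assms by (simp add: d_def)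
  then have g_pos: "g > 0" by (auto simp: g_def vec_eq_iff_2)
  define u :: lpoint where "u = vector [d$1 div g, d$2 div g]"
  have "primitive u" using g_pos unfolding primitive_def u_def g_def vector_2
    by (intro div_gcd_coprime) auto
  moreover have "d = g *s u" by (simp add: vec_eq_iff_2 u_def g_def)
  then have "B = A + g *s u" by (simp add: d_def algebra_simps)
  ultimately show thesis using that[of g] g_pos prim_vec_eqI by metis
qed

lemma primitive_sgn_scaled: "primitive u \<Longrightarrow> a \<noteq> 0 \<Longrightarrow> primitive (sgn a *s u)"
  by (simp add: primitive_def sgn_if)

lemma prim_vec_step:
  assumes "primitive w" "a \<noteq> 0"
  shows "prim_vec A (A + a *s w) = sgn a *s w"
  using assms primitive_sgn_scaled
  by (intro prim_vec_eqI[of _ "\<bar>a\<bar>"]) (auto simp: vector_smult_assoc abs_mult_sgn)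

lemma prim_vec_step_back:
  assumes "primitive w" "a \<noteq> 0"
  shows "prim_vec (A + a *s w) A = - sgn a *s w"
  using prim_vec_step[of w "- a" "A + a *s w"] assms
  by (simp add: add.assoc flip: vector_sadd_rdistrib)

subsection \<open>The lattice inside the Euclidean plane\<close>

lemma emb_add: "emb (P + Q) = emb P + emb Q"
  and emb_diff: "emb (P - Q) = emb P - emb Q"
  and emb_scale: "emb (m *s P) = of_int m *\<^sub>R emb P"
  by (simp_all add: emb_def vec_eq_iff)

lemma emb_eq_iff [simp]: "emb P = emb Q \<longleftrightarrow> P = Q"
  by (simp add: emb_def vec_eq_iff)

lemma cross2_emb: "cross2 (emb u) (emb v) = of_int (cross2 u v)"
  by (simp add: cross2_def emb_def)

lemma collinear_emb_iff: "collinear {emb A, emb B, emb C} \<longleftrightarrow> cross2 (A - B) (C - B) = 0"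
proof -
  have "collinear {emb A, emb B, emb C} \<longleftrightarrow> collinear {0, emb (A - B), emb (C - B)}"
    unfolding emb_diff by (auto simp: collinear_def)
  then show ?thesis by (simp add: collinear_iff_cross2 cross2_emb)
qed

lemma emb_eq_scaleR_primitiveE:
  assumes "primitive u" "emb v = t *\<^sub>R emb u"
  obtains j where "v = j *s u" "t = of_int j"
proof -
  obtain w where dual: "cross2 u w = 1" using assms(1) primitive_iff_cross2 by blast
  define j where "j = cross2 v w"
  have "of_int j = cross2 (emb v) (emb w)" by (simp add: j_def cross2_emb)
  then have t_eq: "t = of_int j" using dual by (simp add: assms(2) cross2_emb)
  then have "emb v = emb (j *s u)" using assms(2) by (simp add: emb_scale)
  then show thesis using that t_eq by simp
qed

lemma lattice_points_closed_segment:
  assumes "primitive u" "m > 0"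
  shows "{P. emb P \<in> closed_segment (emb A) (emb (A + m *s u))} = (\<lambda>j. A + j *s u) ` {0..m}"
proof (intro equalityI subsetI)
  fix P assume "P \<in> {P. emb P \<in> closed_segment (emb A) (emb (A + m *s u))}"
  then obtain t where on_segment: "0 \<le> t" "t \<le> 1"
    "emb P = (1 - t) *\<^sub>R emb A + t *\<^sub>R emb (A + m *s u)"
    by (auto simp: in_segment)
  then have "emb (P - A) = (t * of_int m) *\<^sub>R emb u"
    by (simp add: emb_add emb_diff emb_scale algebra_simps)
  then obtain j where multiple: "P - A = j *s u" "t * of_int m = of_int j"
    using assms(1) emb_eq_scaleR_primitiveE by metis
  have "0 \<le> t * of_int m" "t * of_int m \<le> of_int m"
    using on_segment assms(2) by (auto intro: mult_left_le_one_le)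
  then have "j \<in> {0..m}" unfolding multiple by simp
  moreover have "P = A + j *s u" using multiple(1) by (simp add: algebra_simps)
  ultimately show "P \<in> (\<lambda>j. A + j *s u) ` {0..m}" by blast
next
  fix P assume "P \<in> (\<lambda>j. A + j *s u) ` {0..m}"
  then obtain j where multiple: "0 \<le> j" "j \<le> m" "P = A + j *s u" by auto
  have "emb P = (1 - of_int j / of_int m) *\<^sub>R emb A + (of_int j / of_int m) *\<^sub>R emb (A + m *s u)"
    using assms(2) by (simp add: multiple(3) emb_add emb_scale algebra_simps)
  then show "P \<in> {P. emb P \<in> closed_segment (emb A) (emb (A + m *s u))}"
    using multiple assms(2) unfolding in_segment by (auto intro!: exI[of _ "of_int j / of_int m"])
qed

lemma lattice_length_step:
  assumes "primitive w" "a \<noteq> 0"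
  shows "lattice_length A (A + a *s w) = nat \<bar>a\<bar>"
proof -
  define u where "u = sgn a *s w"
  have u_primitive: "primitive u" using assms by (simp add: u_def primitive_sgn_scaled)
  have scaled: "a *s w = \<bar>a\<bar> *s u" by (simp add: u_def vector_smult_assoc abs_mult_sgn)
  have "inj_on (\<lambda>j. A + j *s u) {0..\<bar>a\<bar>}"
  proof (rule inj_onI)
    fix i j assume "A + i *s u = A + j *s u"
    moreover obtain x where "cross2 u x = 1" using u_primitive primitive_iff_cross2 by blast
    ultimately show "i = j" by (metis add_left_cancel cross2_simps(1) mult.right_neutral)
  qed
  then have "card {P. emb P \<in> closed_segment (emb A) (emb (A + a *s w))} = nat (\<bar>a\<bar> + 1)"
    unfolding scaled using lattice_points_closed_segment[OF u_primitive] assms(2)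
    by (simp add: card_image)
  then show ?thesis by (simp add: lattice_length_def)
qed

lemma osign_eq_cross2: "osign A B C = sgn (cross2 (A - B) (C - B))"
  by (simp add: osign_def det_vector_2)

subsection \<open>The lattice sine\<close>

lemma line_eq_level_set:
  fixes u x :: "real^2"
  assumes "u \<noteq> 0"
  shows "{x + t *\<^sub>R u | t. True} = {y. cross2 u y = cross2 u x}"
proof (intro equalityI subsetI)
  fix y assume "y \<in> {y. cross2 u y = cross2 u x}"
  then have "collinear {0, u, y - x}" by (simp add: collinear_iff_cross2 cross2_distribs)
  then obtain t where "y - x = t *\<^sub>R u"
    using assms unfolding collinear_lemma by (metis scaleR_zero_left)
  then show "y \<in> {x + t *\<^sub>R u | t. True}" by (auto simp: algebra_simps)
qed (auto simp: cross2_distribs)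

definition level_line :: "lpoint \<Rightarrow> lpoint \<Rightarrow> int \<Rightarrow> (real^2) set" where
  "level_line Y u s = {R. cross2 (emb u) (R - emb Y) = of_int s}"

lemma emb_in_level_line_iff: "emb P \<in> level_line Y u s \<longleftrightarrow> cross2 u (P - Y) = s"
  by (simp add: level_line_def cross2_emb flip: emb_diff)

lemma unit_lines_eq_level_lines:
  assumes "Y \<noteq> X"
  defines "u \<equiv> prim_vec Y X"
  shows "unit_lines Y X = {level_line Y u s | s. \<bar>s\<bar> = 1}"
proof -
  obtain w where dual: "cross2 u w = 1"
    using assms prim_vecE primitive_iff_cross2 by metis
  then have u_nonzero: "emb u \<noteq> 0"
    by (metis cross2_emb cross2_simps(6) of_int_1 zero_neq_one)
  have line: "{emb P + t *\<^sub>R emb u | t. True} = level_line Y u (cross2 u (P - Y))" for P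
    unfolding line_eq_level_set[OF u_nonzero] level_line_def
    by (auto simp: emb_diff cross2_distribs simp flip: cross2_emb)
  show ?thesis (is "_ = ?level_lines")
  proof
    show "unit_lines Y X \<subseteq> ?level_lines"
      unfolding unit_lines_def u_def[symmetric] line lattice_basis_iff_cross2 by blast
    have "level_line Y u s \<in> unit_lines Y X" if "\<bar>s\<bar> = 1" for s
      unfolding unit_lines_def u_def[symmetric] line lattice_basis_iff_cross2
      using dual that by (intro CollectI exI[of _ "Y + s *s w"]) simp
    then show "?level_lines \<subseteq> unit_lines Y X" by blast
  qed
qed

lemma level_line_meets_ray_imp_sgn:
  assumes "Q \<in> level_line Y u s" "Q \<in> ray Y (Y + n *s v)" "n > 0" "\<bar>s\<bar> = 1" "cross2 u v \<noteq> 0"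
  shows "s = sgn (cross2 u v)"
proof -
  obtain t where on_ray: "t \<ge> 0" "Q = emb Y + t *\<^sub>R emb (n *s v)"
    using assms(2) unfolding ray_def by (auto simp: emb_add)
  then have "of_int s = (t * of_int n) * (of_int (cross2 u v) :: real)"
    using assms(1) by (simp add: level_line_def emb_scale cross2_emb)
  then have "(of_int (s * cross2 u v) :: real) = (t * of_int n) * (of_int (cross2 u v))\<^sup>2"
    by (simp add: power2_eq_square)
  also have "\<dots> \<ge> 0" using on_ray(1) assms(3) by simp
  finally have "s * cross2 u v \<ge> 0" by linarith
  then show ?thesis using assms(4,5) by (auto simp: sgn_if abs_if split: if_splits)
qed

definition ray_point :: "lpoint \<Rightarrow> lpoint \<Rightarrow> lpoint \<Rightarrow> real^2" where
  "ray_point Y u v = emb Y + (1 / of_int \<bar>cross2 u v\<bar>) *\<^sub>R emb v"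

lemma dist_ray_point:
  assumes "cross2 u v \<noteq> 0" "cross2 u (P - Y) = sgn (cross2 u v)"
  shows "dist (emb P) (ray_point Y u v) =
         \<bar>of_int (cross2 (P - Y) v)\<bar> * (norm (emb u) / of_int \<bar>cross2 u v\<bar>)"
proof -
  define c where "c = cross2 u v"
  have "c *s (P - Y) = cross2 (P - Y) v *s u + sgn c *s v"
    using cross2_cramer[of u v "P - Y"] assms(2) by (simp add: c_def)
  then have "of_int c *\<^sub>R emb (P - Y) =
      of_int (cross2 (P - Y) v) *\<^sub>R emb u + of_int (sgn c) *\<^sub>R emb v"
    by (metis emb_add emb_scale)
  then have "of_int c *\<^sub>R (emb (P - Y) - (1 / of_int \<bar>c\<bar>) *\<^sub>R emb v) =
      of_int (cross2 (P - Y) v) *\<^sub>R emb u"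
    using assms(1) by (simp add: c_def scaleR_diff_right sgn_if)
  then have "\<bar>of_int c\<bar> * norm (emb (P - Y) - (1 / of_int \<bar>c\<bar>) *\<^sub>R emb v) =
      \<bar>of_int (cross2 (P - Y) v)\<bar> * norm (emb u)"
    by (metis norm_scaleR)
  then show ?thesis
    using assms(1) by (simp add: ray_point_def c_def dist_norm emb_diff field_simps)
qed

definition beyond_ray :: "lpoint \<Rightarrow> lpoint \<Rightarrow> lpoint \<Rightarrow> lpoint \<Rightarrow> bool" where
  "beyond_ray Y u v P \<longleftrightarrow>
     cross2 u (P - Y) = sgn (cross2 u v) \<and> sgn (cross2 u v) * sgn (cross2 (P - Y) v) < 0"

lemma beyond_ray_exists:
  assumes "primitive u" "cross2 u v \<noteq> 0"
  shows "\<exists>P. beyond_ray Y u v P"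
proof -
  define c s where "c = cross2 u v" and "s = sgn c"
  have sign: "\<bar>c\<bar> \<ge> 1" "s * s = 1" "s * c = \<bar>c\<bar>"
    using assms(2) by (auto simp: c_def s_def sgn_if)
  obtain w where dual: "cross2 u w = 1" using assms(1) primitive_iff_cross2 by blast
  define P where "P = Y + s *s w - (\<bar>cross2 w v\<bar> + 1) *s u"
  have "s * cross2 (P - Y) v = (s * s) * cross2 w v - (\<bar>cross2 w v\<bar> + 1) * (s * c)"
    by (simp add: P_def cross2_distribs c_def algebra_simps)
  also have "\<dots> < 0"
  proof -
    have "cross2 w v < (\<bar>cross2 w v\<bar> + 1) * 1" by simp
    also have "\<dots> \<le> (\<bar>cross2 w v\<bar> + 1) * \<bar>c\<bar>" using sign(1) by (intro mult_left_mono) auto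
    finally show ?thesis unfolding sign(2,3) by linarith
  qed
  finally have "s * sgn (cross2 (P - Y) v) < 0" by (metis mult_less_0_iff sgn_greater sgn_less)
  moreover have "cross2 u (P - Y) = s" by (simp add: P_def cross2_distribs dual)
  ultimately show ?thesis unfolding beyond_ray_def c_def s_def by blast
qed

text \<open>The distances are natural multiples of one positive real, so the minimum is attained.\<close>

lemma nearest_beyond_ray_exists:
  assumes "primitive u" "cross2 u v \<noteq> 0"
  shows "\<exists>D. is_arg_min (\<lambda>P. dist (emb P) (ray_point Y u v)) (beyond_ray Y u v) D"
proof -
  obtain P where "beyond_ray Y u v P" using beyond_ray_exists[OF assms] by blast
  then obtain D where "is_arg_min (\<lambda>P. nat \<bar>cross2 (P - Y) v\<bar>) (beyond_ray Y u v) D"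
    using is_arg_min_arg_min_nat[of _ P "\<lambda>P. nat \<bar>cross2 (P - Y) v\<bar>"] by blast
  then have nearest: "beyond_ray Y u v D"
    "\<And>P. beyond_ray Y u v P \<Longrightarrow> \<bar>cross2 (D - Y) v\<bar> \<le> \<bar>cross2 (P - Y) v\<bar>"
    by (auto simp: is_arg_min_linorder)
  have "dist (emb D) (ray_point Y u v) \<le> dist (emb P) (ray_point Y u v)"
    if beyond: "beyond_ray Y u v P" for P
  proof -
    have "\<bar>of_int (cross2 (D - Y) v)\<bar> \<le> (\<bar>of_int (cross2 (P - Y) v)\<bar> :: real)"
      using nearest(2)[OF beyond] by linarith
    then show ?thesis
      using nearest(1) beyond dist_ray_point[OF assms(2)]
      by (simp add: beyond_ray_def divide_right_mono mult_right_mono)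
  qed
  then show ?thesis using nearest(1) unfolding is_arg_min_linorder by blast
qed

definition is_lsin :: "lpoint \<Rightarrow> lpoint \<Rightarrow> lpoint \<Rightarrow> int \<Rightarrow> bool" where
  "is_lsin X Y Z x2 \<longleftrightarrow> (\<exists>x1 l Q D.
      l \<in> unit_lines Y X \<and> Q \<in> l \<and> Q \<in> ray Y Z \<and>
      is_arg_min (\<lambda>P. dist (emb P) Q) (\<lambda>P. emb P \<in> l \<and> osign X Y Z * osign P Y Z < 0) D \<and>
      prim_vec Y Z = x1 *s prim_vec Y X + x2 *s (D - Y))"

context
  fixes X Y Z u v :: lpoint
  assumes nondegenerate: "cross2 (X - Y) (Z - Y) \<noteq> 0"
  defines "u \<equiv> prim_vec Y X" and "v \<equiv> prim_vec Y Z"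
begin

lemma angle_sides:
  obtains m n where "m > 0" "n > 0" "primitive u" "X = Y + m *s u" "Z = Y + n *s v"
    "cross2 u v \<noteq> 0"
proof -
  have "Y \<noteq> X" "Y \<noteq> Z" using nondegenerate by auto
  then obtain m n where sides: "m > 0" "n > 0" "primitive u" "X = Y + m *s u" "Z = Y + n *s v"
    unfolding u_def v_def using prim_vecE by metis
  moreover have "cross2 u v \<noteq> 0" using nondegenerate sides by auto
  ultimately show thesis using that by blast
qed

lemma beyond_ray_eq_opposite_side:
  "beyond_ray Y u v =
     (\<lambda>P. emb P \<in> level_line Y u (sgn (cross2 u v)) \<and> osign X Y Z * osign P Y Z < 0)"
proof -
  obtain m n where "m > 0" "n > 0" "X = Y + m *s u" "Z = Y + n *s v" using angle_sides by metis
  then show ?thesis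
    by (simp add: beyond_ray_def fun_eq_iff emb_in_level_line_iff osign_eq_cross2 sgn_mult)
qed

lemma is_lsin_abs_cross2: "is_lsin X Y Z \<bar>cross2 u v\<bar>"
proof -
  define c where "c = cross2 u v"
  define l where "l = level_line Y u (sgn c)"
  define Q where "Q = ray_point Y u v"
  obtain m n where sides: "m > 0" "n > 0" "primitive u" "X = Y + m *s u" "Z = Y + n *s v" "c \<noteq> 0"
    using angle_sides c_def by metis
  have "Y \<noteq> X" using nondegenerate by auto
  then have "l \<in> unit_lines Y X"
    using unit_lines_eq_level_lines sides(6) unfolding l_def u_def by (auto simp: abs_sgn_eq)
  moreover have "Q \<in> l"
    using sides(6)
    by (simp add: Q_def ray_point_def l_def level_line_def cross2_emb c_def[symmetric] sgn_if)
  moreover have "Q = emb Y + (1 / (of_int \<bar>c\<bar> * of_int n)) *\<^sub>R (emb Z - emb Y)"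
    using sides by (simp add: Q_def ray_point_def c_def emb_add emb_scale)
  then have "Q \<in> ray Y Z" using sides(2) unfolding ray_def by fastforce
  moreover obtain D where
    nearest: "is_arg_min (\<lambda>P. dist (emb P) Q) (\<lambda>P. emb P \<in> l \<and> osign X Y Z * osign P Y Z < 0) D"
    using nearest_beyond_ray_exists[OF sides(3) sides(6)[unfolded c_def], of Y]
    unfolding beyond_ray_eq_opposite_side Q_def l_def c_def by blast
  moreover have "v = (sgn c * cross2 v (D - Y)) *s u + \<bar>c\<bar> *s (D - Y)"
  proof -
    have "cross2 u (D - Y) = sgn c"
      using nearest by (simp add: is_arg_min_def l_def emb_in_level_line_iff)
    then have "sgn c *s (sgn c *s v) = sgn c *s (cross2 v (D - Y) *s u + c *s (D - Y))"
      using cross2_cramer[of u "D - Y" v] by (simp add: c_def)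
    then show ?thesis
      using sides(6)
      by (auto simp: vector_add_ldistrib vector_smult_assoc sgn_if abs_if split: if_splits)
  qed
  ultimately show ?thesis unfolding is_lsin_def c_def u_def v_def by blast
qed

lemma is_lsin_unique:
  assumes "is_lsin X Y Z x2"
  shows "x2 = \<bar>cross2 u v\<bar>"
proof -
  obtain m n where sides: "m > 0" "n > 0" "primitive u" "X = Y + m *s u" "Z = Y + n *s v"
    "cross2 u v \<noteq> 0"
    using angle_sides by metis
  obtain x1 l Q D where witness: "l \<in> unit_lines Y X" "Q \<in> l" "Q \<in> ray Y Z" "emb D \<in> l"
    "v = x1 *s u + x2 *s (D - Y)"
    using assms unfolding is_lsin_def is_arg_min_def u_def v_def by blast
  have "Y \<noteq> X" using nondegenerate by auto
  then obtain s where "\<bar>s\<bar> = 1" "l = level_line Y u s"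
    using witness(1) unit_lines_eq_level_lines unfolding u_def by blast
  then have "cross2 u (D - Y) = sgn (cross2 u v)"
    using level_line_meets_ray_imp_sgn witness sides emb_in_level_line_iff by metis
  moreover have "cross2 u v = x2 * cross2 u (D - Y)"
    unfolding witness(5) by (simp add: cross2_distribs right_diff_distrib)
  ultimately have "\<bar>cross2 u v\<bar> = x2 * (sgn (cross2 u v) * sgn (cross2 u v))"
    by (metis abs_sgn mult.assoc)
  then show ?thesis using sides(6) by simp
qed

lemma lsin_eq_abs_cross2: "lsin X Y Z = \<bar>cross2 u v\<bar>"
  unfolding lsin_def is_lsin_def[symmetric]
  using is_lsin_abs_cross2 is_lsin_unique by (rule the_equality)

end

subsection \<open>Broken lines on unit distance from the origin\<close>

lemma broken_line_Cons2 [simp]: "broken_line [A, B] \<longleftrightarrow> A \<noteq> B"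
  by (auto simp: broken_line_def)

lemma broken_line_Cons3 [simp]:
  "broken_line (A # B # C # As) \<longleftrightarrow>
     A \<noteq> B \<and> cross2 (A - B) (C - B) \<noteq> 0 \<and> broken_line (B # C # As)"
  by (auto simp: broken_line_def collinear_emb_iff All_less_Suc2)

lemma broken_line_cases:
  assumes "broken_line As"
  obtains A B L where "As = A # B # L" "A \<noteq> B"
proof -
  have "2 \<le> length As" using assms by (simp add: broken_line_def)
  then obtain A B L where As_eq: "As = A # B # L"
    by (metis Suc_le_length_iff numeral_2_eq_2)
  moreover have "A \<noteq> B" using assms unfolding As_eq by (cases L) auto
  ultimately show thesis using that by blast
qed

lemma unit_distance_single [simp]: "unit_distance V [A]"
  by (simp add: unit_distance_def)

lemma unit_distance_Cons2 [simp]: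
  "unit_distance V (A # B # As) \<longleftrightarrow>
     \<bar>cross2 (prim_vec A B) (V - A)\<bar> = 1 \<and> unit_distance V (B # As)"
  by (auto simp: unit_distance_def lattice_basis_iff_cross2 All_less_Suc2)

lemma signed_length_sine_Cons2:
  "signed_length_sine V [A, B] = [osign A V B * int (lattice_length A B)]"
  by (simp add: signed_length_sine_def upt_rec)

lemma signed_length_sine_Cons3:
  "signed_length_sine V (A # B # C # As) =
     osign A V B * int (lattice_length A B) #
     osign A V B * osign B V C * osign A B C * lsin A B C #
     signed_length_sine V (B # C # As)"
proof -
  have "[0..<Suc (Suc n)] = 0 # 1 # map (\<lambda>j. j + 2) [0..<n]" for n
    by (induction n) auto
  then have "[0..<2 * (length (A # B # C # As) - 1) - 1] =
      0 # 1 # map (\<lambda>j. j + 2) [0..<2 * (length (B # C # As) - 1) - 1]"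
    by simp
  then show ?thesis
    unfolding signed_length_sine_def by (simp add: Let_def o_def)
qed

lemma unit_segmentE:
  assumes "A \<noteq> B" "\<bar>cross2 (prim_vec A B) A\<bar> = 1"
  obtains w a where "cross2 A w = 1" "a \<noteq> 0" "B = A + a *s w"
proof -
  define s where "s = cross2 A (prim_vec A B)"
  have s_squared: "s * s = 1"
    using assms(2) by (metis s_def abs_minus_cancel abs_mult_self_eq cross2_swap mult_1)
  obtain m where along: "m > 0" "B = A + m *s prim_vec A B" using prim_vecE[OF assms(1)] by metis
  show thesis
  proof (rule that)
    show "cross2 A (s *s prim_vec A B) = 1" using s_squared by (simp add: s_def)
    show "m * s \<noteq> 0" using along(1) s_squared by auto
    show "B = A + (m * s) *s (s *s prim_vec A B)"
      using along(2) by (simp add: vector_smult_assoc mult.assoc s_squared)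
  qed
qed

lemma primitive_second_if_cross2: "cross2 A w = 1 \<Longrightarrow> primitive w"
  using primitive_if_abs_cross2[of w A] by (simp add: cross2_swap[of w])

lemma unit_broken_line_origin_induct [consumes 1, case_names point segment]:
  assumes "unit_broken_line 0 As"
    and point: "\<And>A. primitive A \<Longrightarrow> P [A]"
    and segment: "\<And>A w a L. cross2 A w = 1 \<Longrightarrow> a \<noteq> 0 \<Longrightarrow> P ((A + a *s w) # L) \<Longrightarrow>
      P (A # (A + a *s w) # L)"
  shows "P As"
proof -
  have first_segment: "P (A # B # L)"
    if "A \<noteq> B" "unit_distance 0 (A # B # L)" "primitive B \<Longrightarrow> P (B # L)" for A B L
  proof -
    have "\<bar>cross2 (prim_vec A B) A\<bar> = 1" using that(2) by simp
    with that(1) obtain w a where "cross2 A w = 1" "a \<noteq> 0" "B = A + a *s w" by (rule unit_segmentE)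
    moreover from this have "cross2 B w = 1" by (simp add: cross2_distribs)
    then have "P (B # L)" using that(3) primitive_iff_cross2 by blast
    ultimately show ?thesis using segment by blast
  qed
  have two_points: "P (A # B # L)" if "broken_line (A # B # L)" "unit_distance 0 (A # B # L)"
    for A B L
    using that
  proof (induction L arbitrary: A B)
    case Nil
    then show ?case using first_segment point by simp
  next
    case (Cons C L)
    then show ?case using first_segment[of A B "C # L"] by simp
  qed
  from assms(1) consider (line) "broken_line As" "unit_distance 0 As"
    | (point) A where "As = [A]" "primitive (- A)"
    unfolding unit_broken_line_def by auto
  then show ?thesis
  proof cases
    case line
    then show ?thesis using two_points broken_line_cases by metis
  next
    case (point A)
    then show ?thesis using assms(2) by (simp add: primitive_def)
  qed
qed

lemma unit_broken_line_not_Nil: "unit_broken_line V As \<Longrightarrow> As \<noteq> []"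
  by (auto simp: unit_broken_line_def broken_line_def)

lemma primitive_vertex:
  assumes "unit_broken_line 0 As" "P \<in> set As"
  shows "primitive P"
  using assms
proof (induction As rule: unit_broken_line_origin_induct)
  case (segment A w a L)
  then show ?case using primitive_iff_cross2 by auto
qed auto

lemma unit_step:
  assumes "cross2 A w = 1" "B = A + a *s w" "a \<noteq> 0"
  shows "A \<noteq> B" "cross2 B w = 1" "\<bar>cross2 (prim_vec A B) A\<bar> = 1"
    "osign A 0 B = sgn a" "osign A 0 B * int (lattice_length A B) = a"
proof -
  have w_primitive: "primitive w" using assms(1) by (rule primitive_second_if_cross2)
  show "A \<noteq> B" using assms by auto
  show "cross2 B w = 1" using assms by (simp add: cross2_distribs)
  show "\<bar>cross2 (prim_vec A B) A\<bar> = 1"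
    using assms w_primitive by (simp add: prim_vec_step cross2_swap[of w] abs_mult)
  show "osign A 0 B = sgn a" using assms by (simp add: osign_eq_cross2 cross2_distribs)
  then show "osign A 0 B * int (lattice_length A B) = a"
    using assms(2,3) w_primitive by (simp add: lattice_length_step sgn_mult_abs)
qed

lemma unit_corner:
  assumes frame: "cross2 A w = 1" and B_eq: "B = A + a *s w" and a_nonzero: "a \<noteq> 0"
    and C_eq: "C = B + b *s (w + c *s B)" and b_nonzero: "b \<noteq> 0"
  shows "cross2 (A - B) (C - B) = a * b * c"
    and "c \<noteq> 0 \<Longrightarrow> osign A 0 B * osign B 0 C * osign A B C * lsin A B C = c"
proof -
  define w' where "w' = w + c *s B"
  have frames_at_B: "cross2 B w = 1" "cross2 B w' = 1"
    using unit_step[OF frame B_eq a_nonzero] by (simp_all add: w'_def cross2_distribs)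
  have cross2_directions: "cross2 w w' = - c"
    using frames_at_B by (simp add: w'_def cross2_distribs cross2_swap[of w B])
  have primitive_directions: "primitive w" "primitive w'"
    using frames_at_B by (simp_all add: primitive_second_if_cross2)
  have C_eq': "C = B + b *s w'" by (simp add: C_eq w'_def)
  have "A - B = (- a) *s w" by (simp add: B_eq vec_eq_iff_2)
  then show corner: "cross2 (A - B) (C - B) = a * b * c" by (simp add: C_eq' cross2_directions)
  assume c_nonzero: "c \<noteq> 0"
  have "lsin A B C = \<bar>cross2 (prim_vec B A) (prim_vec B C)\<bar>"
    using lsin_eq_abs_cross2 corner a_nonzero b_nonzero c_nonzero by simp
  also have "\<dots> = \<bar>cross2 (- sgn a *s w) (sgn b *s w')\<bar>"
    using prim_vec_step_back[OF primitive_directions(1) a_nonzero, of A]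
      prim_vec_step[OF primitive_directions(2) b_nonzero, of B]
    by (simp add: C_eq' B_eq)
  also have "\<dots> = \<bar>c\<bar>" using a_nonzero b_nonzero by (simp add: cross2_directions abs_mult)
  finally have lsin_eq: "lsin A B C = \<bar>c\<bar>" .
  have "osign A 0 B = sgn a" "osign B 0 C = sgn b" "osign A B C = sgn (a * b * c)"
    using unit_step(4)[OF frame B_eq a_nonzero] unit_step(4)[OF frames_at_B(2) C_eq' b_nonzero]
      corner
    by (simp_all add: osign_eq_cross2[of A B])
  then have "osign A 0 B * osign B 0 C * osign A B C * lsin A B C =
      (sgn a * sgn a) * (sgn b * sgn b) * (sgn c * \<bar>c\<bar>)"
    unfolding lsin_eq by (simp only: sgn_mult mult_ac)
  then show "osign A 0 B * osign B 0 C * osign A B C * lsin A B C = c"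
    using a_nonzero b_nonzero by (simp add: sgn_mult_abs)
qed

text \<open>A segment from \<open>A\<close> on unit distance from the origin is encoded by the vector \<open>w\<close> along it with
  \<open>cross2 A w = 1\<close> and its signed length \<open>a\<close>; a signed sine \<open>c\<close> at its end \<open>B\<close> turns \<open>w\<close> into
  \<open>w + c *s B\<close>.\<close>

fun generated_line :: "lpoint \<Rightarrow> lpoint \<Rightarrow> int list \<Rightarrow> lpoint list" where
  "generated_line A w [] = [A]"
| "generated_line A w [a] = [A, A + a *s w]"
| "generated_line A w (a # c # S) =
     A # generated_line (A + a *s w) (w + c *s (A + a *s w)) S"

lemma generated_line_hd: "generated_line A w S = A # tl (generated_line A w S)"
  by (cases "(A, w, S)" rule: generated_line.cases) auto

lemma hd_generated_line [simp]: "hd (generated_line A w S) = A"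
  by (subst generated_line_hd) simp

lemma generated_line_not_Nil [simp]: "generated_line A w S \<noteq> []"
  by (subst generated_line_hd) simp

lemma generated_line_second:
  obtains L where "generated_line A w (a # S) = A # (A + a *s w) # L"
  using generated_line_hd that by (cases S) auto

lemma generated_line_correct:
  assumes "cross2 A w = 1" "odd (length S)" "0 \<notin> set S"
  shows "broken_line (generated_line A w S) \<and> unit_distance 0 (generated_line A w S) \<and>
         signed_length_sine 0 (generated_line A w S) = S"
  using assms
proof (induction A w S rule: generated_line.induct)
  case (2 A w a)
  then show ?case
    using unit_step[OF "2.prems"(1) refl, of a] by (simp add: signed_length_sine_Cons2)
next
  case (3 A w a c S)
  define B w' where "B = A + a *s w" and "w' = w + c *s B"
  have "S \<noteq> []" using "3.prems"(2) by auto
  then obtain b S' where S_eq: "S = b # S'" by (cases S) auto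
  then have nonzero: "a \<noteq> 0" "b \<noteq> 0" "c \<noteq> 0" using "3.prems"(3) by auto
  obtain L where tail_line: "generated_line B w' S = B # (B + b *s w') # L"
    unfolding S_eq by (rule generated_line_second)
  have step: "A \<noteq> B" "\<bar>cross2 (prim_vec A B) A\<bar> = 1"
      "osign A 0 B * int (lattice_length A B) = a" "cross2 B w' = 1"
    using unit_step[OF "3.prems"(1) B_def nonzero(1)] by (simp_all add: w'_def cross2_distribs)
  have IH: "broken_line (B # (B + b *s w') # L) \<and> unit_distance 0 (B # (B + b *s w') # L) \<and>
      signed_length_sine 0 (B # (B + b *s w') # L) = S"
    using "3.IH" "3.prems"(2,3) step(4)
    unfolding B_def[symmetric] w'_def[symmetric] tail_line by auto
  have line: "generated_line A w (a # c # S) = A # B # (B + b *s w') # L"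
    using tail_line by (simp add: B_def w'_def)
  show ?case
    unfolding line signed_length_sine_Cons3
    using step IH nonzero
      unit_corner[where c = c, OF "3.prems"(1) B_def nonzero(1) refl nonzero(2), folded w'_def]
    by simp
qed simp

lemma eq_generated_line:
  assumes "cross2 A w = 1" "B = A + a *s w"
    "broken_line (A # B # As)" "unit_distance 0 (A # B # As)"
  shows "A # B # As = generated_line A w (signed_length_sine 0 (A # B # As))"
  using assms
proof (induction As arbitrary: A B w a)
  case Nil
  then have "a \<noteq> 0" by auto
  then show ?case using unit_step(5)[OF Nil(1,2)] Nil by (simp add: signed_length_sine_Cons2)
next
  case (Cons C As)
  have a_nonzero: "a \<noteq> 0" using Cons.prems(2,3) by auto
  note step = unit_step[OF Cons.prems(1,2) a_nonzero]
  have "B \<noteq> C" "\<bar>cross2 (prim_vec B C) B\<bar> = 1" using Cons.prems(3,4) by auto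
  then obtain w' b where next_step: "cross2 B w' = 1" "b \<noteq> 0" "C = B + b *s w'"
    by (rule unit_segmentE)
  have "cross2 B (w' - w) = 0" using next_step(1) step(2) by (simp add: cross2_distribs)
  from cross2_eq_0_imp_multiple[OF step(2) this] obtain c where "w' - w = c *s B" by blast
  then have direction: "w' = w + c *s B" by (simp add: algebra_simps)
  note corner =
    unit_corner[OF Cons.prems(1,2) a_nonzero next_step(3)[unfolded direction] next_step(2)]
  have "c \<noteq> 0" using corner(1) Cons.prems(3) by auto
  then have "signed_length_sine 0 (A # B # C # As) = a # c # signed_length_sine 0 (B # C # As)"
    using step corner(2) by (simp add: signed_length_sine_Cons3)
  moreover have "B # C # As = generated_line B w' (signed_length_sine 0 (B # C # As))"
    using Cons.IH[OF next_step(1,3)] Cons.prems(3,4) by simp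
  ultimately show ?case using direction Cons.prems(2) by simp
qed

lemma Phi_eq_angle_generated_line:
  assumes "odd (length S)" "0 \<notin> set S"
  shows "Phi S = angle 0 (generated_line e1 e2 S)"
proof -
  obtain a T where S_eq: "S = a # T" using assms(1) by (cases S) auto
  obtain L where line: "generated_line e1 e2 S = e1 # (e1 + a *s e2) # L"
    unfolding S_eq by (rule generated_line_second)
  have "(THE As. broken_line As \<and> unit_distance 0 As \<and>
     As ! 0 = e1 \<and> (As ! 1) $ 1 = 1 \<and> signed_length_sine 0 As = S) = generated_line e1 e2 S"
  proof (rule the_equality)
    show "broken_line (generated_line e1 e2 S) \<and> unit_distance 0 (generated_line e1 e2 S) \<and>
       generated_line e1 e2 S ! 0 = e1 \<and> (generated_line e1 e2 S ! 1) $ 1 = 1 \<and>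
       signed_length_sine 0 (generated_line e1 e2 S) = S"
      using generated_line_correct[OF cross2_e1_e2 assms] by (simp add: line)
  next
    fix As assume solution: "broken_line As \<and> unit_distance 0 As \<and>
       As ! 0 = e1 \<and> (As ! 1) $ 1 = 1 \<and> signed_length_sine 0 As = S"
    then obtain A B M where As_eq: "As = A # B # M" using broken_line_cases by blast
    then have "A = e1" "B = e1 + B$2 *s e2" using solution by (auto simp: vec_eq_iff_2)
    then show "As = generated_line e1 e2 S"
      using eq_generated_line[OF cross2_e1_e2, of B "B$2" M] solution As_eq by metis
  qed
  then show ?thesis by (simp add: Phi_def)
qed

lemma generated_line_snoc:
  "odd (length S) \<Longrightarrow> generated_line A w (S @ [c]) = generated_line A w S"
  by (induction A w S rule: generated_line.induct) auto

lemma unit_broken_line_generated_line: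
  assumes "cross2 A w = 1" "0 \<notin> set S"
  shows "unit_broken_line 0 (generated_line A w S)"
proof (cases S rule: rev_cases)
  case Nil
  have "primitive (- A)" using primitive_if_abs_cross2[of "- A" w] assms(1) by simp
  then show ?thesis by (simp add: Nil unit_broken_line_def)
next
  case (snoc T c)
  show ?thesis
  proof (cases "odd (length S)")
    case True
    then show ?thesis
      using generated_line_correct[OF assms(1) True assms(2)] by (simp add: unit_broken_line_def)
  next
    case False
    then have "odd (length T)" "0 \<notin> set T" using assms(2) by (simp_all add: snoc)
    then show ?thesis
      using generated_line_correct[OF assms(1)]
      by (simp add: snoc generated_line_snoc unit_broken_line_def)
  qed
qed

lemma map_generated_line:
  assumes "\<And>x y. f (x + y) = f x + f y" "\<And>m x. f (m *s x) = m *s f x"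
  shows "map f (generated_line A w S) = generated_line (f A) (f w) S"
  by (induction A w S rule: generated_line.induct) (simp_all add: assms)

subsection \<open>The turn of a broken line around the origin\<close>

definition to_complex :: "real^2 \<Rightarrow> complex" where
  "to_complex x = Complex (x$1) (x$2)"

abbreviation cpoint :: "lpoint \<Rightarrow> complex" where
  "cpoint P \<equiv> to_complex (emb P)"

lemma to_complex_sel [simp]: "Re (to_complex x) = x$1" "Im (to_complex x) = x$2"
  by (simp_all add: to_complex_def)

lemma emb_nth [simp]: "emb P $ i = of_int (P $ i)"
  by (simp add: emb_def)

lemma cpoint_eq_0_iff [simp]: "cpoint P = 0 \<longleftrightarrow> P = 0"
  by (simp add: complex_eq_iff vec_eq_iff_2)

lemma cpoint_uminus: "cpoint (- P) = - cpoint P"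
  by (simp add: complex_eq_iff)

lemma sgn_Im_cpoint_divide: "sgn (Im (cpoint B / cpoint A)) = of_int (sgn (cross2 A B))"
proof -
  have "Im (cpoint B / cpoint A) = of_int (cross2 A B) / (cmod (cpoint A))\<^sup>2"
    by (simp add: Im_divide cmod_power2 cross2_def mult.commute)
  then show ?thesis by (cases "A = 0") (simp_all add: sgn_if zero_less_divide_iff)
qed

lemma Im_cpoint_divide_nonneg_iff: "0 \<le> Im (cpoint B / cpoint A) \<longleftrightarrow> 0 \<le> cross2 A B"
  and Im_cpoint_divide_eq_0_iff: "Im (cpoint B / cpoint A) = 0 \<longleftrightarrow> cross2 A B = 0"
  using sgn_Im_cpoint_divide[of B A] by (auto simp: sgn_if split: if_splits)

fun turn :: "lpoint list \<Rightarrow> real" where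
  "turn [] = 0"
| "turn [A] = 0"
| "turn (A # B # As) = Arg (cpoint B / cpoint A) + turn (B # As)"

fun nowhere_radial :: "lpoint list \<Rightarrow> bool" where
  "nowhere_radial [] \<longleftrightarrow> False"
| "nowhere_radial [A] \<longleftrightarrow> A \<noteq> 0"
| "nowhere_radial (A # B # As) \<longleftrightarrow> cross2 A B \<noteq> 0 \<and> nowhere_radial (B # As)"

lemma unit_broken_line_nowhere_radial: "unit_broken_line 0 As \<Longrightarrow> nowhere_radial As"
proof (induction As rule: unit_broken_line_origin_induct)
  case (point A)
  then show ?case by (auto simp: primitive_def)
next
  case (segment A w a L)
  then show ?case by (simp add: cross2_distribs)
qed

lemma turn_map_uminus: "turn (map uminus As) = turn As"
  by (induction As rule: turn.induct) (simp_all add: cpoint_uminus)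

lemma cis_turn:
  assumes "nowhere_radial As"
  shows "cis (turn As) = sgn (cpoint (last As) / cpoint (hd As))"
  using assms
proof (induction As rule: turn.induct)
  case (3 A B As)
  then have nonzero: "A \<noteq> 0" "B \<noteq> 0" by auto
  have "cis (turn (A # B # As)) =
      sgn (cpoint B / cpoint A) * sgn (cpoint (last (B # As)) / cpoint B)"
    using 3 nonzero by (simp add: cis_mult[symmetric] cis_Arg)
  also have "\<dots> = sgn (cpoint (last (B # As)) / cpoint A)"
    using nonzero by (subst sgn_mult[symmetric]) (simp del: last.simps)
  finally show ?case by simp
qed auto

lemma Arg_divide_upper_half_plane:
  assumes "Im a \<ge> 0" "Im b \<ge> 0" "Im (b / a) \<noteq> 0"
  shows "Arg (b / a) = Arg b - Arg a"
proof (rule cis_Arg_unique)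
  have nonzero: "a \<noteq> 0" "b \<noteq> 0" using assms(3) by auto
  show sgn_quotient: "sgn (b / a) = cis (Arg b - Arg a)"
    using nonzero by (simp add: cis_divide[symmetric] cis_Arg sgn_divide)
  have Arg_nonneg: "0 \<le> Arg a" "0 \<le> Arg b" using assms(1,2) by (simp_all add: Arg_less_0)
  then show "Arg b - Arg a \<le> pi" using Arg_le_pi[of b] by linarith
  have "Arg b - Arg a \<noteq> - pi"
  proof
    assume "Arg b - Arg a = - pi"
    then have "Im (sgn (b / a)) = 0" unfolding sgn_quotient by simp
    then show False using assms(3) by (auto simp: sgn_div_norm)
  qed
  then show "- pi < Arg b - Arg a" using Arg_nonneg Arg_le_pi[of a] by linarith
qed

lemma turn_half_plane:
  assumes "nowhere_radial As" "\<And>P. P \<in> set As \<Longrightarrow> cross2 A\<^sub>0 P \<ge> 0" "A\<^sub>0 \<noteq> 0"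
  shows "turn As = Arg (cpoint (last As) / cpoint A\<^sub>0) - Arg (cpoint (hd As) / cpoint A\<^sub>0)"
  using assms(1,2)
proof (induction As rule: turn.induct)
  case (3 A B As)
  define a b where "a = cpoint A / cpoint A\<^sub>0" and "b = cpoint B / cpoint A\<^sub>0"
  have quotient: "b / a = cpoint B / cpoint A" using assms(3) by (simp add: a_def b_def)
  have "Im a \<ge> 0" "Im b \<ge> 0"
    using "3.prems"(2) unfolding a_def b_def Im_cpoint_divide_nonneg_iff by simp_all
  moreover have "Im (b / a) \<noteq> 0"
    using "3.prems"(1) unfolding quotient Im_cpoint_divide_eq_0_iff by simp
  ultimately have "Arg (b / a) = Arg b - Arg a" by (rule Arg_divide_upper_half_plane)
  then show ?case using 3 unfolding quotient by (simp add: a_def b_def)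
qed (use assms in auto)

lemma Arg_add_Arg_minus_inverse:
  assumes "Im z \<noteq> 0"
  shows "Arg z + Arg (- inverse z) = sgn (Im z) * pi"
proof -
  have "z \<noteq> 0" "z \<notin> \<real>" using assms by (auto simp: complex_is_Real_iff)
  then show ?thesis
    using assms Arg_neg_iff[of z] by (auto simp: Arg_minus Arg_inverse sgn_if)
qed

subsection \<open>Equivalent lines are those with equal ends and equal turn\<close>

lemma continuous_on_to_complex: "continuous_on S to_complex"
proof -
  have components: "to_complex = (\<lambda>x. of_real (x$1) + \<i> * of_real (x$2))"
    by (rule ext) (simp add: complex_eq_iff)
  show ?thesis unfolding components by (intro continuous_intros)
qed

lemma to_complex_linepath: "to_complex \<circ> linepath x y = linepath (to_complex x) (to_complex y)"
  by (rule ext) (simp add: linepath_def complex_eq_iff)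

lemma null_homotopic_compose_iff:
  assumes "continuous_on S f" "f \<in> S \<rightarrow> T" "continuous_on T g" "g \<in> T \<rightarrow> S" "\<And>x. g (f x) = x"
  shows "(\<exists>c. homotopic_loops T (f \<circ> p) (linepath c c)) \<longleftrightarrow> (\<exists>c. homotopic_loops S p (linepath c c))"
proof
  assume "\<exists>c. homotopic_loops S p (linepath c c)"
  then obtain c where "homotopic_loops S p (linepath c c)" by blast
  then have "homotopic_loops T (f \<circ> p) (f \<circ> linepath c c)"
    using assms(1,2) by (rule homotopic_loops_continuous_image)
  then show "\<exists>c. homotopic_loops T (f \<circ> p) (linepath c c)" by (auto simp: linepath_refl o_def)
next
  assume "\<exists>c. homotopic_loops T (f \<circ> p) (linepath c c)"
  then obtain c where "homotopic_loops T (f \<circ> p) (linepath c c)" by blast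
  then have "homotopic_loops S (g \<circ> (f \<circ> p)) (g \<circ> linepath c c)"
    using assms(3,4) by (rule homotopic_loops_continuous_image)
  then show "\<exists>c. homotopic_loops S p (linepath c c)"
    using assms(5) by (auto simp: linepath_refl o_def)
qed

lemma null_homotopic_iff_winding_number:
  assumes "path (to_complex \<circ> p)" "0 \<notin> path_image (to_complex \<circ> p)"
  shows "(\<exists>c. homotopic_loops (UNIV - {0}) p (linepath c c)) \<longleftrightarrow>
         winding_number (to_complex \<circ> p) 0 = 0"
proof -
  define of_complex :: "complex \<Rightarrow> real^2" where "of_complex z = vector [Re z, Im z]" for z
  have components: "of_complex = (\<lambda>z. Re z *\<^sub>R vector [1, 0] + Im z *\<^sub>R vector [0, 1])"
    by (rule ext) (simp add: of_complex_def vec_eq_iff_2)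
  have "continuous_on (- {0}) of_complex" unfolding components by (intro continuous_intros)
  moreover have "to_complex \<in> UNIV - {0} \<rightarrow> - {0}" "of_complex \<in> - {0} \<rightarrow> UNIV - {0}"
    "\<And>x. of_complex (to_complex x) = x"
    by (auto simp: of_complex_def complex_eq_iff vec_eq_iff_2)
  ultimately have "(\<exists>c. homotopic_loops (UNIV - {0}) p (linepath c c)) \<longleftrightarrow>
      (\<exists>c. homotopic_loops (- {0}) (to_complex \<circ> p) (linepath c c))"
    using null_homotopic_compose_iff[OF continuous_on_to_complex] by metis
  then show ?thesis
    using winding_number_homotopic_loops_null_eq[OF assms] by (simp add: linepath_refl)
qed

lemma Re_winding_number_linepath:
  assumes "0 \<notin> closed_segment z w"
  shows "2 * pi * Re (winding_number (linepath z w) 0) = Arg (w / z)"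
proof (rule cis_Arg_unique[symmetric])
  let ?n = "winding_number (linepath z w) 0"
  have "z \<noteq> 0" using assms by auto
  moreover have "w = exp (2 * pi * \<i> * ?n) * z"
    using winding_number_exp_2pi[of "linepath z w" 0] assms by simp
  ultimately have "w / z = exp (2 * pi * \<i> * ?n)" by (metis nonzero_eq_divide_eq)
  then show "sgn (w / z) = cis (2 * pi * Re ?n)"
    by (simp add: exp_eq_polar sgn_mult sgn_of_real)
  have "\<bar>Re ?n\<bar> < 1/2" using winding_number_lt_half_linepath[OF assms] .
  then have "\<bar>2 * pi * Re ?n\<bar> < pi" by (simp add: abs_mult)
  then show "- pi < 2 * pi * Re ?n" "2 * pi * Re ?n \<le> pi" by linarith+
qed

lemma zero_notin_closed_segment:
  assumes "cross2 A B \<noteq> 0"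
  shows "0 \<notin> closed_segment (cpoint A) (cpoint B)"
proof
  assume "0 \<in> closed_segment (cpoint A) (cpoint B)"
  then obtain t where "(1 - t) *\<^sub>R cpoint A + t *\<^sub>R cpoint B = 0" unfolding in_segment by metis
  then have "(1 - t) *\<^sub>R emb A + t *\<^sub>R emb B = 0" by (simp add: complex_eq_iff vec_eq_iff_2)
  then have "cross2 (emb A) ((1 - t) *\<^sub>R emb A + t *\<^sub>R emb B) = 0"
    "cross2 ((1 - t) *\<^sub>R emb A + t *\<^sub>R emb B) (emb B) = 0" by simp_all
  then show False using assms by (simp add: cross2_distribs cross2_emb)
qed

lemma broken_path_props:
  assumes "nowhere_radial As"
  defines "p \<equiv> to_complex \<circ> broken_path As"
  shows "path p \<and> 0 \<notin> path_image p \<and> pathstart p = cpoint (hd As) \<and>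
    pathfinish p = cpoint (last As) \<and> 2 * pi * Re (winding_number p 0) = turn As"
  using assms(1) unfolding p_def
proof (induction As rule: broken_path.induct)
  case (1 A)
  then show ?case unfolding broken_path.simps to_complex_linepath
    by (simp del: linepath_trivial)
next
  case (2 A B)
  then have "0 \<notin> closed_segment (cpoint A) (cpoint B)" by (simp add: zero_notin_closed_segment)
  then show ?case by (simp add: to_complex_linepath Re_winding_number_linepath)
next
  case (3 A B C As)
  then have segment: "0 \<notin> closed_segment (cpoint A) (cpoint B)" and "nowhere_radial (B # C # As)"
    by (simp_all add: zero_notin_closed_segment)
  define q where "q = to_complex \<circ> broken_path (B # C # As)"
  note IH = "3.IH"[OF \<open>nowhere_radial (B # C # As)\<close>, folded q_def]
  show ?case
    unfolding broken_path.simps path_compose_join to_complex_linepath q_def[symmetric]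
    using segment IH Re_winding_number_linepath[OF segment]
    by (simp add: path_image_join winding_number_join ring_distribs)
qed (use assms in auto)

lemma null_homotopic_iff_turn_eq:
  assumes "nowhere_radial As" "nowhere_radial Bs" "hd As = hd Bs" "last As = last Bs"
  shows "(\<exists>c. homotopic_loops (UNIV - {0})
            (broken_path As +++ reversepath (broken_path Bs)) (linepath c c)) \<longleftrightarrow> turn As = turn Bs"
proof -
  let ?p = "to_complex \<circ> broken_path As" and ?q = "to_complex \<circ> broken_path Bs"
  note p_props = broken_path_props[OF assms(1)] and q_props = broken_path_props[OF assms(2)]
  let ?l = "?p +++ reversepath ?q"
  have compose: "to_complex \<circ> (broken_path As +++ reversepath (broken_path Bs)) = ?l"
    by (simp add: path_compose_join path_compose_reversepath)
  have loop: "path ?l" "0 \<notin> path_image ?l" "pathfinish ?l = pathstart ?l"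
    using p_props q_props assms(3,4) by (auto simp: path_image_join)
  have "winding_number ?l 0 = winding_number ?p 0 - winding_number ?q 0"
    using p_props q_props assms(3,4) by (simp add: winding_number_join winding_number_reversepath)
  then have "2 * pi * Re (winding_number ?l 0) = turn As - turn Bs"
    using p_props q_props by (simp add: right_diff_distrib)
  moreover have "winding_number ?l 0 \<in> \<int>" by (rule integer_winding_number[OF loop(1,3,2)])
  then have "winding_number ?l 0 = 0 \<longleftrightarrow> 2 * pi * Re (winding_number ?l 0) = 0"
    by (auto simp: complex_eq_iff elim!: Ints_cases)
  ultimately have "winding_number ?l 0 = 0 \<longleftrightarrow> turn As = turn Bs" by simp
  then show ?thesis
    using null_homotopic_iff_winding_number[of "broken_path As +++ reversepath (broken_path Bs)"]
      loop(1,2)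
    unfolding compose by blast
qed

lemma line_equiv_iff_turn:
  "line_equiv 0 As Bs \<longleftrightarrow> unit_broken_line 0 As \<and> unit_broken_line 0 Bs \<and>
     hd As = hd Bs \<and> last As = last Bs \<and> turn As = turn Bs"
proof -
  have "emb 0 = 0" by (simp add: vec_eq_iff_2)
  then show ?thesis
    unfolding line_equiv_def
    using null_homotopic_iff_turn_eq unit_broken_line_nowhere_radial by metis
qed

lemma angle_eqI: "line_equiv 0 As Bs \<Longrightarrow> angle 0 As = angle 0 Bs"
  by (auto simp: angle_def line_equiv_iff_turn)

subsection \<open>Proper lattice-affine transformations\<close>

lemma det_1_imp_invertible:
  fixes M :: "'a::comm_ring_1^2^2"
  assumes "det M = 1"
  shows "invertible M"
proof -
  define N :: "'a^2^2" where "N = vector [vector [M$2$2, - M$1$2], vector [- M$2$1, M$1$1]]"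
  have "M ** N = mat 1" "N ** M = mat 1"
    using assms
    by (simp_all add: N_def det_2 vec_eq_iff_2 matrix_matrix_mult_def sum_2 mat_def algebra_simps)
  then show ?thesis unfolding invertible_def by blast
qed

lemma proper_lattice_affine_iff:
  "proper_lattice_affine f \<longleftrightarrow> (\<exists>M b. det M = 1 \<and> f = (\<lambda>x. M *v x + b))"
  unfolding proper_lattice_affine_def using det_1_imp_invertible by blast

lemma proper_lattice_affine_comp:
  assumes "proper_lattice_affine f" "proper_lattice_affine g"
  shows "proper_lattice_affine (g \<circ> f)"
proof -
  obtain M b where f_matrix: "det M = 1" "f = (\<lambda>x. M *v x + b)"
    using assms(1) proper_lattice_affine_iff by blast
  obtain N c where g_matrix: "det N = 1" "g = (\<lambda>x. N *v x + c)"
    using assms(2) proper_lattice_affine_iff by blast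
  have "g \<circ> f = (\<lambda>x. (N ** M) *v x + (N *v b + c))"
    by (rule ext)
      (simp add: f_matrix g_matrix matrix_vector_right_distrib matrix_vector_mul_assoc add.assoc)
  moreover have "det (N ** M) = 1" by (simp add: det_mul f_matrix g_matrix)
  ultimately show ?thesis unfolding proper_lattice_affine_iff by blast
qed

lemma proper_lattice_affine_inverseE:
  assumes "proper_lattice_affine f"
  obtains g where "proper_lattice_affine g" "\<And>x. g (f x) = x" "\<And>x. f (g x) = x"
proof -
  obtain M b where f_matrix: "invertible M" "det M = 1" "f = (\<lambda>x. M *v x + b)"
    using assms unfolding proper_lattice_affine_def by blast
  obtain N where N_inverse: "M ** N = mat 1" "N ** M = mat 1"
    using f_matrix(1) unfolding invertible_def by blast
  define g where "g x = N *v x + - (N *v b)" for x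
  have "det N = 1" using f_matrix(2) N_inverse(1) by (metis det_I det_mul mult_1)
  then have "proper_lattice_affine g" unfolding proper_lattice_affine_iff g_def by blast
  moreover have "g (f x) = x" "f (g x) = x" for x
    by (simp_all add: f_matrix g_def N_inverse matrix_vector_right_distrib
        matrix_vector_mult_diff_distrib matrix_vector_mul_assoc)
  ultimately show thesis using that by blast
qed

lemma emb_matrix_vector_mult: "emb (M *v x) = map_matrix of_int M *v emb x"
  by (simp add: vec_eq_iff_2 matrix_vector_mult_def sum_2)

lemma proper_lattice_affine_extendE:
  assumes "proper_lattice_affine f"
  obtains F where "\<And>P. F (emb P) = emb (f P)" "\<And>x y. F \<circ> linepath x y = linepath (F x) (F y)"
    "continuous_on UNIV F" "inj F"
proof -
  obtain M b where f_matrix: "det M = 1" "f = (\<lambda>x. M *v x + b)"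
    using assms(1) proper_lattice_affine_iff by blast
  define M' :: "real^2^2" where "M' = map_matrix of_int M"
  define F where "F x = M' *v x + emb b" for x
  have "det M' = of_int (det M)" by (simp add: M'_def det_2)
  then have "invertible M'" using f_matrix(1) by (intro det_1_imp_invertible) simp
  then have "inj F" using inj_matrix_vector_mult by (auto simp: F_def inj_def)
  moreover have "F (emb P) = emb (f P)" for P
    by (simp add: F_def M'_def f_matrix emb_add emb_matrix_vector_mult)
  moreover have "F \<circ> linepath x y = linepath (F x) (F y)" for x y
    by (rule ext) (simp add: F_def linepath_def matrix_vector_right_distrib
        matrix_vector_mult_scaleR algebra_simps)
  moreover have "continuous_on UNIV F" unfolding F_def by (intro continuous_intros)
  ultimately show thesis using that by blast
qed

lemma unit_broken_line_map:
  assumes "proper_lattice_affine f" "unit_broken_line V As"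
  shows "unit_broken_line (f V) (map f As)"
proof -
  obtain M b where f_matrix: "det M = 1" "f = (\<lambda>x. M *v x + b)"
    using assms(1) proper_lattice_affine_iff by blast
  have cross2: "cross2 (M *v u) (M *v v) = cross2 u v" for u v
    by (simp add: cross2_matrix_mult f_matrix(1))
  have diff: "f x - f y = M *v (x - y)" for x y
    by (simp add: f_matrix(2) matrix_vector_mult_diff_distrib)
  have scale: "M *v (m *s u) = m *s (M *v u)" for m u
    by (simp add: vec_eq_iff_2 matrix_vector_mult_def sum_2 algebra_simps)
  have primitive: "primitive (M *v u)" if "primitive u" for u
    using that cross2 primitive_iff_cross2 by metis
  have inj: "f x = f y \<longleftrightarrow> x = y" for x y
    using proper_lattice_affine_inverseE[OF assms(1)] by metis
  have prim_vec: "prim_vec (f A) (f B) = M *v prim_vec A B" if "A \<noteq> B" for A B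
  proof -
    obtain m where along: "m > 0" "primitive (prim_vec A B)" "B = A + m *s prim_vec A B"
      using prim_vecE \<open>A \<noteq> B\<close> by metis
    have "f B = f A + m *s (M *v prim_vec A B)"
      by (subst along(3)) (simp add: f_matrix(2) matrix_vector_right_distrib scale add_ac)
    then show ?thesis using along(1,2) primitive by (intro prim_vec_eqI) auto
  qed
  from assms(2) consider (line) "broken_line As" "unit_distance V As"
    | (point) A where "As = [A]" "primitive (V - A)"
    unfolding unit_broken_line_def by auto
  then show ?thesis
  proof cases
    case line
    then have "broken_line (map f As)" "unit_distance (f V) (map f As)"
      unfolding broken_line_def unit_distance_def collinear_emb_iff lattice_basis_iff_cross2
      by (simp_all add: inj diff cross2 prim_vec)
    then show ?thesis unfolding unit_broken_line_def by blast
  next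
    case point
    then show ?thesis unfolding unit_broken_line_def by (simp add: diff primitive)
  qed
qed

lemma line_equiv_map:
  assumes proper: "proper_lattice_affine f" and equiv: "line_equiv V As Bs"
  shows "line_equiv (f V) (map f As) (map f Bs)"
proof -
  obtain F where extension: "\<And>P. F (emb P) = emb (f P)"
    "\<And>x y. F \<circ> linepath x y = linepath (F x) (F y)" "continuous_on UNIV F" "inj F"
    using proper_lattice_affine_extendE[OF proper] by metis
  have path: "F \<circ> broken_path Cs = broken_path (map f Cs)" if "Cs \<noteq> []" for Cs
    using that by (induction Cs rule: broken_path.induct)
      (simp_all add: path_compose_join extension del: linepath_trivial)
  have unit: "unit_broken_line V As" "unit_broken_line V Bs" and nonempty: "As \<noteq> []" "Bs \<noteq> []"
    using equiv unit_broken_line_not_Nil unfolding line_equiv_def by blast+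
  obtain c where null_homotopic: "homotopic_loops (UNIV - {emb V})
       (broken_path As +++ reversepath (broken_path Bs)) (linepath c c)"
    using equiv unfolding line_equiv_def by blast
  have "continuous_on (UNIV - {emb V}) F" using extension(3) continuous_on_subset by blast
  moreover have "F \<in> UNIV - {emb V} \<rightarrow> UNIV - {emb (f V)}"
    using extension(4) by (auto simp: inj_eq simp flip: extension(1))
  ultimately have "homotopic_loops (UNIV - {emb (f V)})
       (F \<circ> (broken_path As +++ reversepath (broken_path Bs))) (F \<circ> linepath c c)"
    by (rule homotopic_loops_continuous_image[OF null_homotopic])
  then have "homotopic_loops (UNIV - {emb (f V)})
       (broken_path (map f As) +++ reversepath (broken_path (map f Bs))) (linepath (F c) (F c))"
    unfolding path_compose_join path_compose_reversepath
      path[OF nonempty(1)] path[OF nonempty(2)] extension(2) .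
  then show ?thesis
    using unit_broken_line_map[OF proper] unit equiv nonempty
    by (auto simp: line_equiv_def hd_map last_map)
qed

subsection \<open>Proper congruence of expanded angles\<close>

lemma proper_congruent_sym:
  assumes "proper_congruent \<alpha> \<beta>"
  shows "proper_congruent \<beta> \<alpha>"
proof -
  obtain f where f_maps: "proper_lattice_affine f" "f (fst \<alpha>) = fst \<beta>" "map f ` snd \<alpha> = snd \<beta>"
    using assms unfolding proper_congruent_def by blast
  obtain g where g_inverse: "proper_lattice_affine g" "\<And>x. g (f x) = x"
    using proper_lattice_affine_inverseE[OF f_maps(1)] by metis
  have "map g ` snd \<beta> = snd \<alpha>"
    unfolding f_maps(3)[symmetric] by (simp add: image_image o_def g_inverse(2))
  moreover have "g (fst \<beta>) = fst \<alpha>" unfolding f_maps(2)[symmetric] by (rule g_inverse(2))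
  ultimately show ?thesis unfolding proper_congruent_def using g_inverse(1) by blast
qed

lemma proper_congruent_trans:
  assumes "proper_congruent \<alpha> \<beta>" "proper_congruent \<beta> \<gamma>"
  shows "proper_congruent \<alpha> \<gamma>"
proof -
  obtain f where f_maps: "proper_lattice_affine f" "f (fst \<alpha>) = fst \<beta>" "map f ` snd \<alpha> = snd \<beta>"
    using assms(1) unfolding proper_congruent_def by blast
  obtain g where g_maps: "proper_lattice_affine g" "g (fst \<beta>) = fst \<gamma>" "map g ` snd \<beta> = snd \<gamma>"
    using assms(2) unfolding proper_congruent_def by blast
  have "map (g \<circ> f) ` snd \<alpha> = snd \<gamma>"
    unfolding g_maps(3)[symmetric] f_maps(3)[symmetric] by (simp add: image_image)
  moreover have "(g \<circ> f) (fst \<alpha>) = fst \<gamma>" by (simp add: f_maps(2) g_maps(2))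
  ultimately show ?thesis
    unfolding proper_congruent_def using proper_lattice_affine_comp[OF f_maps(1) g_maps(1)] by blast
qed

lemma proper_congruent_angle_map:
  assumes proper: "proper_lattice_affine f"
  shows "proper_congruent (angle V As) (angle (f V) (map f As))"
proof -
  obtain g where g_inverse: "proper_lattice_affine g" "\<And>x. g (f x) = x" "\<And>x. f (g x) = x"
    using proper_lattice_affine_inverseE[OF proper] by metis
  have "map f ` {Bs. line_equiv V As Bs} = {Bs. line_equiv (f V) (map f As) Bs}"
  proof (intro equalityI subsetI)
    fix Bs assume "Bs \<in> {Bs. line_equiv (f V) (map f As) Bs}"
    then have "line_equiv (g (f V)) (map g (map f As)) (map g Bs)"
      using line_equiv_map[OF g_inverse(1)] by blast
    then have "line_equiv V As (map g Bs)" by (simp add: g_inverse o_def)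
    moreover have "Bs = map f (map g Bs)" by (simp add: g_inverse o_def)
    ultimately show "Bs \<in> map f ` {Bs. line_equiv V As Bs}" by blast
  qed (use line_equiv_map[OF proper] in blast)
  then show ?thesis unfolding proper_congruent_def angle_def using proper by auto
qed

lemma proper_congruent_angleE:
  assumes "proper_congruent (angle V As) (angle 0 Bs)" "unit_broken_line 0 Bs"
  obtains f where "proper_lattice_affine f" "f V = 0" "line_equiv 0 (map f As) Bs"
proof -
  obtain f where f_maps: "proper_lattice_affine f" "f V = 0"
    "map f ` {Cs. line_equiv V As Cs} = {Cs. line_equiv 0 Bs Cs}"
    using assms(1) unfolding proper_congruent_def angle_def by auto
  have "line_equiv 0 Bs Bs" using assms(2) by (simp add: line_equiv_iff_turn)
  then obtain Cs where "line_equiv V As Cs" "Bs = map f Cs" using f_maps(3) by blast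
  then have "line_equiv 0 (map f As) Bs" using line_equiv_map[OF f_maps(1)] f_maps(2) by metis
  then show thesis using that f_maps by blast
qed

subsection \<open>Coordinates in a frame, and shears\<close>

definition frame_coords :: "lpoint \<Rightarrow> lpoint \<Rightarrow> lpoint \<Rightarrow> lpoint \<Rightarrow> lpoint" where
  "frame_coords V P w x = vector [cross2 (x - V) w, cross2 P (x - V)]"

lemma proper_lattice_affine_frame_coords:
  assumes "cross2 P w = 1"
  shows "proper_lattice_affine (frame_coords V P w)"
proof -
  define M :: "int^2^2" where "M = vector [vector [w$2, - w$1], vector [- P$2, P$1]]"
  have "frame_coords V P w = (\<lambda>x. M *v x + - (M *v V))"
    by (rule ext)
      (simp add: M_def frame_coords_def vec_eq_iff_2 matrix_vector_mult_def sum_2 cross2_def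
        algebra_simps)
  moreover have "det M = 1" using assms by (simp add: M_def det_2 cross2_def mult.commute)
  ultimately show ?thesis unfolding proper_lattice_affine_iff by blast
qed

lemma frame_coords_origin [simp]: "frame_coords V P w V = 0"
  by (simp add: frame_coords_def vec_eq_iff_2)

lemma primitive_vertex_diff:
  assumes "unit_broken_line V As" "P \<in> set As"
  shows "primitive (P - V)"
proof -
  have coords: "frame_coords V e1 e2 x = x - V" for x
    by (simp add: frame_coords_def vec_eq_iff_2 cross2_def)
  have "proper_lattice_affine (frame_coords V e1 e2)"
    using cross2_e1_e2 by (rule proper_lattice_affine_frame_coords)
  then have "unit_broken_line 0 (map (frame_coords V e1 e2) As)"
    using unit_broken_line_map[OF _ assms(1)] frame_coords_origin by metis
  then show ?thesis using primitive_vertex assms(2) by (fastforce simp: coords)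
qed

definition shear :: "int \<Rightarrow> lpoint \<Rightarrow> lpoint" where
  "shear m v = vector [v$1 + m * v$2, v$2]"

lemma shear_nth [simp]: "shear m v $ 1 = v$1 + m * v$2" "shear m v $ 2 = v$2"
  by (simp_all add: shear_def)

lemma frame_coords_shear: "frame_coords V P (w - m *s P) x = shear m (frame_coords V P w x)"
  by (simp add: frame_coords_def vec_eq_iff_2 cross2_distribs cross2_swap[of _ P] algebra_simps)

lemma proper_lattice_affine_eq_shear:
  assumes "proper_lattice_affine f" "f 0 = 0" "f e1 = e1"
  obtains m where "f = shear m"
proof -
  obtain M b where f_matrix: "det M = 1" "f = (\<lambda>x. M *v x + b)"
    using assms(1) proper_lattice_affine_iff by blast
  have "b = 0" using assms(2) f_matrix(2) by simp
  moreover have "M$1$1 = 1" "M$2$1 = 0"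
    using assms(3) f_matrix(2) \<open>b = 0\<close> by (simp_all add: vec_eq_iff_2 matrix_vector_mult_def sum_2)
  moreover have "M$2$2 = 1" using f_matrix(1) calculation by (simp add: det_2)
  ultimately have "f x = shear (M$1$2) x" for x
    by (simp add: f_matrix(2) vec_eq_iff_2 matrix_vector_mult_def sum_2)
  then show thesis using that by blast
qed

subsection \<open>Continued fractions\<close>

text \<open>The direction \<open>(q, p)\<close> of slope \<open>p / q = [a\<^sub>0; a\<^sub>1, \<dots>, a\<^sub>2\<^sub>n]\<close>.\<close>

fun cf_vector :: "int list \<Rightarrow> lpoint" where
  "cf_vector [] = e1"
| "cf_vector [a] = vector [1, a]"
| "cf_vector (a # c # S) =
     (let v = cf_vector S; q = v$1 + c * v$2 in vector [q, v$2 + a * q])"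

lemma last_generated_line:
  assumes "odd (length S) \<or> S = []"
  shows "last (generated_line A w S) = cf_vector S $ 1 *s A + cf_vector S $ 2 *s w"
  using assms
proof (induction A w S rule: generated_line.induct)
  case (3 A w a c S)
  then show ?case by (simp add: vec_eq_iff_2 Let_def algebra_simps)
qed simp_all

lemma cf_elements_iff: "cf_elements S \<longleftrightarrow> odd (length S) \<and> (\<forall>a\<in>set S. a > 0)"
  by (auto simp: cf_elements_def elim: oddE)

lemma cf_elements_simps [simp]:
  "\<not> cf_elements []" "cf_elements [a] \<longleftrightarrow> a > 0"
  "cf_elements (a # c # S) \<longleftrightarrow> a > 0 \<and> c > 0 \<and> cf_elements S"
  by (auto simp: cf_elements_iff)

lemma cf_vector_bounds:
  assumes "cf_elements S"
  shows "1 \<le> cf_vector S $ 1 \<and> cf_vector S $ 1 \<le> cf_vector S $ 2"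
  using assms
proof (induction S rule: cf_vector.induct)
  case (3 a c S)
  define q where "q = cf_vector S $ 1 + c * cf_vector S $ 2"
  have "1 \<le> cf_vector S $ 1" "1 \<le> cf_vector S $ 2" "a \<ge> 1" "c \<ge> 1" using 3 by auto
  then have "q \<ge> 1" by (simp add: q_def add_increasing2)
  then have "q \<le> a * q" using \<open>a \<ge> 1\<close> by (simp add: mult_le_cancel_right1)
  then have "q \<le> cf_vector S $ 2 + a * q" using \<open>1 \<le> cf_vector S $ 2\<close> by linarith
  then show ?case using \<open>q \<ge> 1\<close> by (simp add: Let_def q_def[symmetric])
qed auto

lemma cf_vector_Cons2_decode:
  assumes "cf_elements (a # c # S)" "cf_vector (a # c # S) = vector [q, p]"
  shows "q > 1" "a = p div q" "cf_vector S $ 2 = p mod q"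
    "c = (q - 1) div (p mod q)" "cf_vector S $ 1 = (q - 1) mod (p mod q) + 1"
proof -
  define q' p' where "q' = cf_vector S $ 1" and "p' = cf_vector S $ 2"
  have q_eq: "q = q' + c * p'" using assms(2) by (simp add: Let_def vec_eq_iff_2 q'_def p'_def)
  then have p_eq: "p = p' + a * q" using assms(2) by (simp add: Let_def vec_eq_iff_2 q'_def p'_def)
  have bounds: "1 \<le> q'" "q' \<le> p'" "c \<ge> 1"
    using cf_vector_bounds[of S] assms(1) by (auto simp: q'_def p'_def)
  then have "p' \<le> c * p'" by (simp add: mult_le_cancel_right1)
  then have "0 \<le> p'" "p' < q" using bounds q_eq by linarith+
  then show "q > 1" "a = p div q" using bounds by (simp_all add: p_eq)
  have p'_eq: "p' = p mod q" using \<open>0 \<le> p'\<close> \<open>p' < q\<close> by (simp add: p_eq)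
  then show "cf_vector S $ 2 = p mod q" by (simp add: p'_def)
  have q_pred: "q - 1 = (q' - 1) + c * p'" by (simp add: q_eq)
  have "(q - 1) div p' = c" "(q - 1) mod p' = q' - 1" unfolding q_pred using bounds by simp_all
  then show "c = (q - 1) div (p mod q)" "cf_vector S $ 1 = (q - 1) mod (p mod q) + 1"
    by (simp_all add: p'_eq[symmetric] q'_def[symmetric])
qed

lemma cf_vector_inject:
  assumes "cf_elements S" "cf_elements T" "cf_vector S = cf_vector T"
  shows "S = T"
  using assms
proof (induction S arbitrary: T rule: cf_vector.induct)
  case (2 a)
  then show ?case
    using cf_vector_Cons2_decode(1) by (cases T rule: cf_vector.cases) (auto simp: vec_eq_iff_2)
next
  case (3 a c S)
  obtain q p where S_pair: "cf_vector (a # c # S) = vector [q, p]" by (simp add: Let_def)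
  note S_decode = cf_vector_Cons2_decode[OF "3.prems"(1) S_pair]
  have "cf_vector T = vector [q, p]" using "3.prems"(3) S_pair by simp
  moreover from this obtain b d T' where T_eq: "T = b # d # T'"
    using S_decode(1) "3.prems"(2) by (cases T rule: cf_vector.cases) (auto simp: vec_eq_iff_2)
  ultimately have "cf_vector (b # d # T') = vector [q, p]" by simp
  note T'_decode = cf_vector_Cons2_decode[OF "3.prems"(2)[unfolded T_eq] this]
  have "cf_vector S = cf_vector T'" using S_decode T'_decode by (simp add: vec_eq_iff_2)
  then have "S = T'" using "3.IH" "3.prems"(1,2) T_eq by simp
  then show ?case using S_decode T'_decode T_eq by simp
qed simp

lemma cf_vector_exists:
  assumes "1 \<le> q" "q \<le> p" "coprime q p"
  shows "\<exists>S. cf_elements S \<and> cf_vector S = vector [q, p]"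
  using assms
proof (induction "nat q" arbitrary: q p rule: less_induct)
  case less
  show ?case
  proof (cases "q = 1")
    case True
    then show ?thesis using less.prems by (intro exI[of _ "[p]"]) simp
  next
    case False
    define a r where "a = p div q" and "r = p mod q"
    define c q' where "c = (q - 1) div r" and "q' = (q - 1) mod r + 1"
    have p_eq: "p = r + a * q" by (simp add: a_def r_def)
    have q_eq: "q = q' + c * r" by (simp add: c_def q'_def)
    have "r \<noteq> 0"
    proof
      assume "r = 0"
      then have "q dvd p" by (simp add: r_def dvd_eq_mod_eq_0)
      then have "is_unit q" using less.prems(3) by (metis coprime_absorb_left)
      then show False using False less.prems(1) by simp
    qed
    moreover have "0 \<le> r" "r < q" using less.prems(1) by (simp_all add: r_def)
    ultimately have r_bounds: "0 < r" "r < q" by simp_all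
    then have q'_bounds: "1 \<le> q'" "q' \<le> r" by (simp_all add: q'_def add1_zle_eq)
    have "a > 0" "c > 0"
      using less.prems r_bounds by (simp_all add: a_def c_def pos_imp_zdiv_pos_iff)
    have "gcd q p = gcd q r" "gcd r q = gcd r q'"
      using gcd_add_mult p_eq q_eq by (metis add.commute)+
    then have "coprime q' r" using less.prems(3) by (metis coprime_iff_gcd_eq_1 gcd.commute)
    then obtain S where "cf_elements S" "cf_vector S = vector [q', r]"
      using less.hyps[of q' r] q'_bounds r_bounds by fastforce
    then have "cf_elements (a # c # S) \<and> cf_vector (a # c # S) = vector [q, p]"
      using \<open>a > 0\<close> \<open>c > 0\<close> by (simp flip: p_eq q_eq)
    then show ?thesis by blast
  qed
qed

lemma positive_generated_line_left:
  assumes "\<forall>a\<in>set S. a > 0" "cross2 A\<^sub>0 A \<ge> 0" "cross2 A\<^sub>0 w \<ge> 0"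
    "P \<in> set (generated_line A w S)"
  shows "cross2 A\<^sub>0 P \<ge> 0"
  using assms
proof (induction A w S rule: generated_line.induct)
  case (3 A w a c S)
  define B where "B = A + a *s w"
  have "a > 0" "c > 0" using "3.prems"(1) by auto
  then have "cross2 A\<^sub>0 B \<ge> 0" using "3.prems"(2,3) by (simp add: B_def cross2_distribs)
  moreover from this have "cross2 A\<^sub>0 (w + c *s B) \<ge> 0"
    using "3.prems"(3) \<open>c > 0\<close> by (simp add: cross2_distribs)
  ultimately show ?case using 3 unfolding B_def by auto
qed (auto simp: cross2_distribs)

subsection \<open>Normal forms\<close>

definition normal_tail :: "int list \<Rightarrow> bool" where
  "normal_tail S \<longleftrightarrow> S = [] \<or> cf_elements S"

lemma normal_tail_pos: "normal_tail S \<Longrightarrow> \<forall>a\<in>set S. a > 0"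
  by (auto simp: normal_tail_def cf_elements_iff)

lemma normal_tail_bounds:
  assumes "normal_tail S"
  shows "1 \<le> cf_vector S $ 1" "0 \<le> cf_vector S $ 2" "cf_vector S $ 2 = 0 \<longleftrightarrow> S = []"
  using assms cf_vector_bounds[of S] by (auto simp: normal_tail_def)

lemma last_generated_line_normal_tail:
  assumes "normal_tail S"
  shows "last (generated_line A w S) = cf_vector S $ 1 *s A + cf_vector S $ 2 *s w"
  using assms by (intro last_generated_line) (auto simp: normal_tail_def cf_elements_iff)

lemma primitive_reduction:
  assumes "primitive P"
  obtains m \<sigma> S where "\<bar>\<sigma>\<bar> = 1" "normal_tail S" "shear m P = \<sigma> *s cf_vector S"
proof (cases "P$2 = 0")
  case True
  then have "\<bar>P$1\<bar> = 1" using assms by (simp add: primitive_def)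
  moreover have "shear 0 P = P$1 *s cf_vector []" using True by (simp add: vec_eq_iff_2)
  ultimately show thesis using that normal_tail_def by blast
next
  case False
  define \<sigma> p x where "\<sigma> = sgn (P$2)" and "p = \<bar>P$2\<bar>" and "x = \<sigma> * P$1"
  define q m where "q = (x - 1) mod p + 1" and "m = - ((x - 1) div p)"
  have sign: "\<bar>\<sigma>\<bar> = 1" "\<sigma> * \<sigma> = 1" and "p > 0" using False by (auto simp: \<sigma>_def p_def sgn_if)
  have P_eq: "P = \<sigma> *s vector [x, p]"
    using sign(2) by (simp add: vec_eq_iff_2 x_def \<sigma>_def p_def sgn_mult_abs flip: mult.assoc)
  have q_eq: "q = x + m * p"
    using div_mult_mod_eq[of "x - 1" p] by (simp add: q_def m_def algebra_simps)
  have "primitive (vector [x, p])"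
    using assms sign(1) unfolding P_eq by (auto simp: primitive_def abs_if split: if_splits)
  then have "coprime q p"
    unfolding q_eq primitive_def
    by (metis add.commute coprime_iff_gcd_eq_1 gcd.commute gcd_add_mult vector_2)
  moreover have "1 \<le> q" "q \<le> p" using \<open>p > 0\<close> by (simp_all add: q_def add1_zle_eq)
  ultimately obtain S where expansion: "cf_elements S" "cf_vector S = vector [q, p]"
    using cf_vector_exists by blast
  have "shear m P = \<sigma> *s cf_vector S"
    unfolding P_eq expansion(2) q_eq by (simp add: vec_eq_iff_2 algebra_simps)
  then show thesis using that sign(1) expansion(1) normal_tail_def by blast
qed

lemma shear_cf_vector_inject:
  assumes "normal_tail S" "normal_tail T" "shear m (cf_vector S) = cf_vector T"
  shows "S = T"
proof (cases "S = []")
  case True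
  then show ?thesis using assms normal_tail_bounds(3)[of T] by (simp add: vec_eq_iff_2)
next
  case False
  define q p where "q = cf_vector S $ 1" and "p = cf_vector S $ 2"
  have T_vector: "cf_vector T = vector [q + m * p, p]"
    using assms(3)[symmetric] by (simp add: vec_eq_iff_2 q_def p_def)
  then have "T \<noteq> []"
    using False normal_tail_bounds(3)[OF assms(1)] normal_tail_bounds(3)[OF assms(2)]
    by (simp add: p_def)
  then have both_cf: "cf_elements S" "cf_elements T"
    using False assms(1,2) by (simp_all add: normal_tail_def)
  have "1 \<le> q" "q \<le> p" "1 \<le> q + m * p" "q + m * p \<le> p"
    using cf_vector_bounds[OF both_cf(1)] cf_vector_bounds[OF both_cf(2)] T_vector
    by (simp_all add: q_def p_def)
  then have "\<bar>m * p\<bar> < p" by linarith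
  then have "\<bar>m\<bar> * p < 1 * p" using \<open>1 \<le> q\<close> \<open>q \<le> p\<close> by (simp add: abs_mult)
  then have "m = 0" using \<open>1 \<le> q\<close> \<open>q \<le> p\<close> unfolding mult_less_cancel_right by linarith
  then have "cf_vector S = cf_vector T" by (simp add: T_vector vec_eq_iff_2 q_def p_def)
  then show ?thesis using cf_vector_inject both_cf by blast
qed

lemma turn_normal_tail:
  assumes "cross2 A w = 1" "normal_tail S"
  defines "L \<equiv> generated_line A w S"
  shows "turn L = Arg (cpoint (last L) / cpoint A)" "0 \<le> turn L" "turn L < pi"
proof -
  have A_nonzero: "A \<noteq> 0" using assms(1) by auto
  have "unit_broken_line 0 L"
    unfolding L_def using normal_tail_pos[OF assms(2)]
    by (intro unit_broken_line_generated_line assms(1)) blast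
  moreover have "cross2 A P \<ge> 0" if "P \<in> set L" for P
    using positive_generated_line_left[OF normal_tail_pos[OF assms(2)], of A A w P] assms(1) that
    unfolding L_def by simp
  ultimately show turn_eq: "turn L = Arg (cpoint (last L) / cpoint A)"
    using turn_half_plane[of L A] A_nonzero unit_broken_line_nowhere_radial by (simp add: L_def)
  have cross2_last: "cross2 A (last L) = cf_vector S $ 2"
    unfolding L_def last_generated_line_normal_tail[OF assms(2)]
    using assms(1) by (simp add: cross2_distribs)
  have "Im (cpoint (last L) / cpoint A) \<ge> 0"
    unfolding Im_cpoint_divide_nonneg_iff cross2_last using normal_tail_bounds(2)[OF assms(2)] .
  then show "0 \<le> turn L" unfolding turn_eq by (simp only: Arg_less_0)
  have "turn L \<noteq> pi"
  proof
    assume "turn L = pi"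
    then have "Im (cpoint (last L) / cpoint A) = 0" unfolding turn_eq Arg_eq_pi by blast
    then have "S = []"
      using normal_tail_bounds(3)[OF assms(2)]
      unfolding Im_cpoint_divide_eq_0_iff cross2_last by blast
    then show False using \<open>turn L = pi\<close> by (simp add: L_def)
  qed
  then show "turn L < pi" using Arg_le_pi unfolding turn_eq by (simp add: order_less_le)
qed

definition half_turn :: "int \<Rightarrow> int list" where
  "half_turn \<epsilon> = [\<epsilon>, - 2 * \<epsilon>, \<epsilon>, - 2 * \<epsilon>]"

definition half_turns :: "int \<Rightarrow> int list" where
  "half_turns k = copies (half_turn (sgn k)) (nat \<bar>k\<bar>)"

lemma copies_0: "copies xs 0 = []" and copies_Suc: "copies xs (Suc n) = xs @ copies xs n"
  by (simp_all add: copies_def)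

lemma copies_Suc_right: "copies xs (Suc n) = copies xs n @ xs"
  by (induction n) (simp_all add: copies_def)

lemma even_length_copies: "even (length xs) \<Longrightarrow> even (length (copies xs n))"
  by (induction n) (simp_all add: copies_0 copies_Suc)

lemma generated_line_half_turn:
  assumes "\<bar>\<epsilon>\<bar> = 1"
  shows "generated_line A w (half_turn \<epsilon> @ S) =
    A # (A + \<epsilon> *s w) # map uminus (generated_line A w S)"
proof -
  have "\<epsilon> = 1 \<or> \<epsilon> = -1" using assms by linarith
  then have "A + \<epsilon> *s w + \<epsilon> *s (w + (- 2 * \<epsilon>) *s (A + \<epsilon> *s w)) = - A"
    "w + (- 2 * \<epsilon>) *s (A + \<epsilon> *s w) + (- 2 * \<epsilon>) *s (- A) = - w"
    by (auto simp: vec_eq_iff_2)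
  moreover have "map uminus (generated_line A w S) = generated_line (- A) (- w) S"
    by (rule map_generated_line) (simp_all add: vec_eq_iff_2)
  ultimately show ?thesis by (simp only: half_turn_def generated_line.simps append.simps)
qed

lemma turn_half_turn:
  assumes "cross2 A w = 1" "\<bar>\<epsilon>\<bar> = 1" "hd L = A" "L \<noteq> []"
  shows "turn (A # (A + \<epsilon> *s w) # map uminus L) = of_int \<epsilon> * pi + turn L"
proof -
  define z where "z = cpoint (A + \<epsilon> *s w) / cpoint A"
  have "sgn (Im z) = of_int (sgn (cross2 A (A + \<epsilon> *s w)))"
    unfolding z_def by (rule sgn_Im_cpoint_divide)
  then have sgn_Im: "sgn (Im z) = of_int \<epsilon>"
    using assms(1,2) by (auto simp: cross2_distribs sgn_if abs_if split: if_splits)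
  then have "Im z \<noteq> 0" using assms(2) by auto
  obtain M where "L = A # M" using assms(3,4) by (cases L) simp_all
  then have "turn (A # (A + \<epsilon> *s w) # map uminus L) =
      Arg z + Arg (cpoint (- A) / cpoint (A + \<epsilon> *s w)) + turn (map uminus L)"
    by (simp add: z_def)
  also have "cpoint (- A) / cpoint (A + \<epsilon> *s w) = - inverse z"
    by (simp add: z_def cpoint_uminus)
  also have "Arg z + Arg (- inverse z) = of_int \<epsilon> * pi"
    using Arg_add_Arg_minus_inverse[OF \<open>Im z \<noteq> 0\<close>] unfolding sgn_Im .
  finally show ?thesis by (simp only: turn_map_uminus)
qed

lemma generated_line_copies_half_turn:
  fixes S :: "int list"
  assumes "cross2 A w = 1" "\<bar>\<epsilon>\<bar> = 1"
  defines "L n \<equiv> generated_line A w (copies (half_turn \<epsilon>) n @ S)"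
  shows "turn (L n) = of_int \<epsilon> * of_nat n * pi + turn (L 0) \<and> last (L n) = (-1)^n *s last (L 0)"
proof (induction n)
  case (Suc n)
  have L_Suc: "L (Suc n) = A # (A + \<epsilon> *s w) # map uminus (L n)"
    unfolding L_def copies_Suc append_assoc by (rule generated_line_half_turn[OF assms(2)])
  have "turn (L (Suc n)) = of_int \<epsilon> * pi + turn (L n)"
    unfolding L_Suc by (rule turn_half_turn[OF assms(1,2)]) (simp_all add: L_def)
  moreover have "last (L (Suc n)) = - last (L n)"
    unfolding L_Suc by (simp add: last_map L_def)
  ultimately show ?case using Suc.IH by (simp add: vec_eq_iff_2 algebra_simps)
qed simp

lemma generated_line_half_turns:
  assumes "cross2 A w = 1"
  shows "turn (generated_line A w (half_turns k @ S)) =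
      of_int k * pi + turn (generated_line A w S)" (is ?turn)
    and "last (generated_line A w (half_turns k @ S)) =
      (-1)^nat \<bar>k\<bar> *s last (generated_line A w S)" (is ?last)
proof -
  have "?turn \<and> ?last"
  proof (cases "k = 0")
    case True
    then show ?thesis by (simp add: half_turns_def copies_0)
  next
    case False
    then have "\<bar>sgn k\<bar> = 1" by (simp add: abs_sgn_eq)
    moreover have "of_int (sgn k) * of_nat (nat \<bar>k\<bar>) = (of_int k :: real)" by (simp add: sgn_if)
    ultimately show ?thesis
      using generated_line_copies_half_turn[OF assms, of "sgn k" "nat \<bar>k\<bar>" S]
      unfolding half_turns_def copies_0 by simp
  qed
  then show ?turn ?last by blast+
qed

fun normal_form_of :: "int \<Rightarrow> int list \<Rightarrow> normal_form" where
  "normal_form_of k [] =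
     (if k = 0 then Type_I else if k > 0 then Type_II (nat k) else Type_III (nat (- k)))"
| "normal_form_of k (a # S) =
     (if k \<ge> 0 then Type_IV (nat k) (a # S) else Type_V (nat (- k)) (a # S))"

lemma valid_form_normal_form_of: "normal_tail S \<Longrightarrow> valid_form (normal_form_of k S)"
  by (cases S) (auto simp: normal_tail_def)

lemma valid_formE:
  assumes "valid_form F"
  obtains k S where "normal_tail S" "F = normal_form_of k S"
proof (cases F)
  case Type_I
  then show thesis using that[of "[]" 0] by (simp add: normal_tail_def)
next
  case (Type_II n)
  then show thesis using that[of "[]" "int n"] assms by (simp add: normal_tail_def)
next
  case (Type_III n)
  then show thesis using that[of "[]" "- int n"] assms by (simp add: normal_tail_def)
next
  case (Type_IV n S)
  then show thesis using that[of S "int n"] assms by (cases S) (auto simp: normal_tail_def)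
next
  case (Type_V n S)
  then show thesis using that[of S "- int n"] assms by (cases S) (auto simp: normal_tail_def)
qed

definition normal_line :: "int \<Rightarrow> int list \<Rightarrow> lpoint list" where
  "normal_line k S = generated_line e1 e2 (half_turns k @ S)"

lemma zero_notin_half_turns: "0 \<notin> set (half_turns k)"
  by (auto simp: half_turns_def half_turn_def copies_def sgn_0_0)

lemma unit_broken_line_normal_line: "normal_tail S \<Longrightarrow> unit_broken_line 0 (normal_line k S)"
  unfolding normal_line_def using zero_notin_half_turns normal_tail_pos
  by (intro unit_broken_line_generated_line cross2_e1_e2) fastforce

text \<open>A trailing sine does not move the generated line, so types I, II and III are the case of an
  empty continued fraction.\<close>

lemma Phi_half_turns:
  assumes "k \<noteq> 0"
  defines "\<epsilon> \<equiv> sgn k"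
  shows "Phi (copies (half_turn \<epsilon>) (nat \<bar>k\<bar> - 1) @ [\<epsilon>, - 2 * \<epsilon>, \<epsilon>]) =
    angle 0 (normal_line k [])" (is "Phi ?T = _")
proof -
  have "copies (half_turn \<epsilon>) (Suc (nat \<bar>k\<bar> - 1)) = ?T @ [- 2 * \<epsilon>]"
    unfolding copies_Suc_right by (simp add: half_turn_def)
  then have half_turns_eq: "half_turns k = ?T @ [- 2 * \<epsilon>]"
    using assms(1) by (simp add: half_turns_def \<epsilon>_def)
  have "odd (length ?T)" by (simp add: even_length_copies half_turn_def)
  moreover have "0 \<notin> set ?T" using zero_notin_half_turns[of k] unfolding half_turns_eq by auto
  ultimately have "Phi ?T = angle 0 (generated_line e1 e2 ?T)"
    by (rule Phi_eq_angle_generated_line)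
  also have "generated_line e1 e2 ?T = normal_line k []"
    unfolding normal_line_def half_turns_eq append_Nil2
    using generated_line_snoc[OF \<open>odd (length ?T)\<close>] by metis
  finally show ?thesis .
qed

lemma form_angle_normal_form_of:
  assumes "normal_tail S"
  shows "form_angle (normal_form_of k S) = angle 0 (normal_line k S)"
proof (cases S)
  case Nil
  then show ?thesis
    using Phi_half_turns[of k]
    by (cases k "0::int" rule: linorder_cases)
      (simp_all add: normal_line_def half_turns_def half_turn_def copies_0)
next
  case (Cons a T)
  then have S_cf: "cf_elements S" using assms by (simp add: normal_tail_def)
  then have "odd (length (half_turns k @ S))"
    by (simp add: cf_elements_iff half_turns_def half_turn_def even_length_copies)
  moreover have "0 \<notin> set (half_turns k @ S)"
    using S_cf zero_notin_half_turns by (auto simp: cf_elements_iff)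
  ultimately have "Phi (half_turns k @ S) = angle 0 (normal_line k S)"
    unfolding normal_line_def by (rule Phi_eq_angle_generated_line)
  moreover have "form_angle (normal_form_of k S) = Phi (half_turns k @ S)"
    by (cases "k = 0") (auto simp: Cons half_turns_def half_turn_def copies_0)
  ultimately show ?thesis by simp
qed

subsection \<open>Classification\<close>

lemma normalized_line_exists:
  assumes "unit_broken_line V As"
  obtains f \<sigma> S where "proper_lattice_affine f" "f V = 0" "normal_tail S" "\<bar>\<sigma>\<bar> = 1"
    "hd (map f As) = e1" "last (map f As) = \<sigma> *s cf_vector S"
proof -
  have nonempty: "As \<noteq> []" using assms by (rule unit_broken_line_not_Nil)
  define P where "P = hd As - V"
  have "primitive P" using primitive_vertex_diff[OF assms] nonempty by (simp add: P_def)
  then obtain w where frame: "cross2 P w = 1" using primitive_iff_cross2 by blast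
  define Q where "Q = frame_coords V P w (last As)"
  have "unit_broken_line 0 (map (frame_coords V P w) As)"
    using unit_broken_line_map[OF proper_lattice_affine_frame_coords[OF frame] assms, of V]
    by simp
  then have "primitive Q" using primitive_vertex nonempty by (simp add: Q_def)
  then obtain m \<sigma> S where reduction: "\<bar>\<sigma>\<bar> = 1" "normal_tail S" "shear m Q = \<sigma> *s cf_vector S"
    by (rule primitive_reduction)
  define f where "f = frame_coords V P (w - m *s P)"
  have "cross2 P (w - m *s P) = 1" using frame by (simp add: cross2_distribs)
  then have "proper_lattice_affine f" unfolding f_def by (rule proper_lattice_affine_frame_coords)
  moreover have "hd (map f As) = e1"
    using nonempty frame
    by (simp add: hd_map f_def frame_coords_def P_def[symmetric] cross2_distribs)
  moreover have "last (map f As) = \<sigma> *s cf_vector S"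
    using nonempty reduction(3) by (simp add: last_map f_def frame_coords_shear Q_def)
  ultimately show thesis using that reduction(1,2) f_def by simp
qed

lemma cis_eq_signE:
  assumes "cis x = of_int \<sigma>" "\<bar>\<sigma>\<bar> = 1"
  obtains k :: int where "x = of_int k * pi" "(-1)^nat \<bar>k\<bar> = \<sigma>"
proof -
  have "sin x = 0" and cos_x: "cos x = of_int \<sigma>" using assms(1) by (simp_all add: complex_eq_iff)
  then obtain k :: int where multiple: "x = of_int k * pi" by (auto simp: sin_zero_iff_int2)
  then have "(-1)^nat \<bar>k\<bar> = \<sigma>"
    using cos_x cos_npi_int[of k] by (auto simp: even_nat_iff mult.commute split: if_splits)
  then show thesis using multiple that by blast
qed

lemma line_equiv_normal_line_exists:
  assumes "unit_broken_line 0 As" "hd As = e1" "last As = \<sigma> *s cf_vector S"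
    and "\<bar>\<sigma>\<bar> = 1" "normal_tail S"
  obtains k where "line_equiv 0 As (normal_line k S)"
proof -
  define R where "R = cf_vector S"
  have "R \<noteq> 0" using normal_tail_bounds(1)[OF assms(5)] by (auto simp: R_def)
  have cpoint_e1: "cpoint e1 = 1" by (simp add: complex_eq_iff)
  have last_base: "last (generated_line e1 e2 S) = R"
    unfolding last_generated_line_normal_tail[OF assms(5)] by (simp add: R_def vec_eq_iff_2)
  then have turn_base: "turn (generated_line e1 e2 S) = Arg (cpoint R)"
    using turn_normal_tail(1)[OF cross2_e1_e2 assms(5)] cpoint_e1 by simp
  have "\<sigma> = 1 \<or> \<sigma> = -1" using assms(4) by linarith
  then have "sgn (cpoint (\<sigma> *s R)) = of_int \<sigma> * sgn (cpoint R)"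
    by (auto simp: cpoint_uminus sgn_minus simp flip: vector_sneg_minus1)
  then have "cis (turn As) = of_int \<sigma> * cis (Arg (cpoint R))"
    using cis_turn[OF unit_broken_line_nowhere_radial[OF assms(1)]] assms(2,3) \<open>R \<noteq> 0\<close>
    by (simp add: cpoint_e1 R_def cis_Arg)
  then have "cis (turn As - Arg (cpoint R)) = of_int \<sigma>" by (simp add: cis_divide[symmetric])
  then obtain k where multiple: "turn As - Arg (cpoint R) = of_int k * pi" "(-1)^nat \<bar>k\<bar> = \<sigma>"
    using assms(4) by (rule cis_eq_signE)
  have "line_equiv 0 As (normal_line k S)"
    unfolding line_equiv_iff_turn
    using assms unit_broken_line_normal_line[OF assms(5), of k] multiple last_base turn_base
      generated_line_half_turns[OF cross2_e1_e2, of k S]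
    by (auto simp: normal_line_def R_def)
  then show thesis by (rule that)
qed

lemma normal_form_exists:
  assumes "unit_broken_line V As"
  obtains k S where "normal_tail S"
    "proper_congruent (angle V As) (form_angle (normal_form_of k S))"
proof -
  obtain f \<sigma> S where normalization: "proper_lattice_affine f" "f V = 0" "normal_tail S" "\<bar>\<sigma>\<bar> = 1"
    "hd (map f As) = e1" "last (map f As) = \<sigma> *s cf_vector S"
    using normalized_line_exists[OF assms] .
  have "unit_broken_line 0 (map f As)"
    using unit_broken_line_map[OF normalization(1) assms] normalization(2) by simp
  then obtain k where "line_equiv 0 (map f As) (normal_line k S)"
    using line_equiv_normal_line_exists normalization(3-6) by blast
  then have "angle 0 (map f As) = form_angle (normal_form_of k S)"
    using angle_eqI form_angle_normal_form_of[OF normalization(3)] by simp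
  then show thesis
    using that[OF normalization(3)] proper_congruent_angle_map[OF normalization(1), of V As]
      normalization(2) by simp
qed

lemma half_turns_decomposition_unique:
  fixes \<theta> \<phi> :: real
  assumes "of_int k * pi + \<theta> = of_int j * pi + \<phi>" "0 \<le> \<theta>" "\<theta> < pi" "0 \<le> \<phi>" "\<phi> < pi"
  shows "k = j"
proof -
  have "\<bar>of_int (k - j) * pi\<bar> < 1 * pi" using assms by (simp add: left_diff_distrib abs_less_iff)
  then have "\<bar>of_int (k - j)\<bar> < (1::real)" by (simp add: abs_mult)
  then show ?thesis by linarith
qed

lemma sheared_normal_line_unique:
  assumes S_tail: "normal_tail S" and T_tail: "normal_tail T"
    and equiv: "line_equiv 0 (map (shear m) (normal_line k S)) (normal_line j T)"
  shows "k = j \<and> S = T"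
proof -
  define w where "w = shear m e2"
  have frame: "cross2 e1 w = 1" by (simp add: w_def cross2_def)
  have "map (shear m) (normal_line k S) = generated_line e1 w (half_turns k @ S)"
    unfolding normal_line_def w_def
    by (subst map_generated_line) (simp_all add: vec_eq_iff_2 algebra_simps, simp add: shear_def)
  then have turn_eq: "of_int k * pi + turn (generated_line e1 w S) =
      of_int j * pi + turn (generated_line e1 e2 T)"
    and last_eq: "(-1)^nat \<bar>k\<bar> *s last (generated_line e1 w S) =
      (-1)^nat \<bar>j\<bar> *s last (generated_line e1 e2 T)"
    using equiv unfolding line_equiv_iff_turn normal_line_def
    by (simp_all add: generated_line_half_turns frame cross2_e1_e2)
  have "k = j"
    using turn_eq turn_normal_tail(2,3)[OF frame S_tail]
      turn_normal_tail(2,3)[OF cross2_e1_e2 T_tail]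
    by (rule half_turns_decomposition_unique)
  moreover have "last (generated_line e1 w S) = last (generated_line e1 e2 T)"
    using last_eq \<open>k = j\<close> by (simp add: vec_eq_iff_2)
  then have "shear m (cf_vector S) = cf_vector T"
    using S_tail T_tail
    by (auto simp: last_generated_line_normal_tail vec_eq_iff_2 w_def mult.commute)
  ultimately show ?thesis using shear_cf_vector_inject S_tail T_tail by blast
qed

lemma normal_form_unique:
  assumes S_tail: "normal_tail S" and T_tail: "normal_tail T"
    and "proper_congruent \<alpha> (form_angle (normal_form_of k S))"
    and "proper_congruent \<alpha> (form_angle (normal_form_of j T))"
  shows "normal_form_of k S = normal_form_of j T"
proof -
  have "proper_congruent (angle 0 (normal_line k S)) (angle 0 (normal_line j T))"
    using assms proper_congruent_sym proper_congruent_trans form_angle_normal_form_of by metis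
  then obtain f where f_equiv: "proper_lattice_affine f" "f 0 = 0"
    "line_equiv 0 (map f (normal_line k S)) (normal_line j T)"
    using unit_broken_line_normal_line[OF T_tail] by (rule proper_congruent_angleE)
  have "f e1 = e1" using f_equiv(3) by (simp add: line_equiv_iff_turn hd_map normal_line_def)
  then obtain m where "f = shear m" using proper_lattice_affine_eq_shear f_equiv(1,2) by blast
  then show ?thesis using sheared_normal_line_unique[OF S_tail T_tail] f_equiv(3) by blast
qed

theorem theorem3p14:
  fixes \<alpha> :: exp_angle
  assumes "expanded_lattice_angle \<alpha>"
  shows "\<exists>!F. valid_form F \<and> proper_congruent \<alpha> (form_angle F)"
proof -
  obtain V As where "unit_broken_line V As" "\<alpha> = angle V As"
    using assms unfolding expanded_lattice_angle_def by blast
  then obtain k S where normal_form: "normal_tail S"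
    "proper_congruent \<alpha> (form_angle (normal_form_of k S))"
    using normal_form_exists by metis
  show ?thesis
  proof (rule ex1I)
    show "valid_form (normal_form_of k S) \<and> proper_congruent \<alpha> (form_angle (normal_form_of k S))"
      using normal_form valid_form_normal_form_of by blast
  next
    fix F assume F_valid: "valid_form F \<and> proper_congruent \<alpha> (form_angle F)"
    then obtain j T where T_form: "normal_tail T" "F = normal_form_of j T"
      using valid_formE by metis
    then show "F = normal_form_of k S"
      using normal_form_unique[OF T_form(1) normal_form(1)] F_valid normal_form(2) by blast
  qed
qed

end
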